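(* Let $(p_j)_{j\in\mathbb{Z}}$ be a sequence of non-negative integers and let $U^{(p_j)}=(U,\mathcal{O}_U)$ be a $\mathbb{Z}$-graded domain of dimension $(p_j)_{j\in\mathbb{Z}}$. Then $U^{(p_j)}$ is a $\mathbb{Z}$-graded locally ringed space.
   Context: A $\mathbb{Z}$-graded vector space is a direct sum $\mathcal{V}=\bigoplus_{i\in\mathbb{Z}}\mathcal{V}_i$ of real vector spaces, with $\dim \mathcal{V}_i<\infty$ for all $i$; nonzero elements of $\mathcal{V}_i$ are homogeneous of degree $i$, and $|\cdot|$ denotes the degree. A graded basis is a sequence of homogeneous elements such that those of degree $i$ form a basis of $\mathcal{V}_i$, for all $i$. For a $\mathbb{Z}$-graded vector space $\mathcal{W}$, $\mathbf{S}\mathcal{W}=\bigotimes\mathcal{W}/J$, where $\bigotimes\mathcal{W}=\bigoplus_{k\ge 0}\otimes^k\mathcal{W}$ is the free graded associative algebra (degree induced by $\mathcal{W}$) and $J$ is the ideal generated by $u\otimes v-(-1)^{|u||v|}v\otimes u$ for homogeneous $u,v\in\mathcal{W}$. $\overline{\mathbf{S}\mathcal{W}}$ denotes its completion obtained by allowing formal power series in a graded basis of $\mathcal{W}$ instead of only polynomials. Graded domain: let $(p_j)_{j\in\mathbb{Z}}$ be non-negative integers and $\mathcal{W}=\bigoplus_j\mathcal{W}_j$ a $\mathbb{Z}$-graded vector space with $\dim\mathcal{W}_0=0$ and $\dim\mathcal{W}_j=p_j$ for $j\neq 0$. $U^{(p_j)}=(U,\mathcal{O}_U)$ is a $\mathbb{Z}$-graded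 domain of dimension $(p_j)_{j}$ if $U$ is an open subset of $\mathbb{R}^{p_0}$ and for all open $V\subseteq U$, $\mathcal{O}_U(V)=\mathcal{C}^\infty_{\mathbb{R}^{p_0}}(V)\otimes\overline{\mathbf{S}\mathcal{W}}$. Here the tensor product is understood so that, for a graded basis $(w_\alpha)_\alpha$ of $\mathcal{W}$, the sections over $V$ are exactly the formal series $f=f_0+\sum_{K=1}^\infty\sum_{\alpha_1\leqslant\ldots\leqslant\alpha_K}f_{\alpha_1\ldots\alpha_K}w_{\alpha_1}\cdots w_{\alpha_K}$ with unique smooth coefficients $f_0,f_{\alpha_1\ldots\alpha_K}$ on $V$ (monomials that vanish by supercommutativity being omitted). A $\mathbb{Z}$-graded ring is a $\mathbb{Z}$-graded abelian group $\mathcal{R}=\bigoplus_i\mathcal{R}_i$ with a multiplication satisfying $\mathcal{R}_i\mathcal{R}_j\subseteq\mathcal{R}_{i+j}$; it is supercommutative if $ab=(-1)^{|a||b|}ba$ for homogeneous $a,b$. A homogeneous ideal is an ideal $I$ with $I=\bigoplus_k (I\cap\mathcal{R}_k)$ (equivalently, generated by homogeneous elements). A homogeneous ideal $I\subsetneq\mathcal{R}$ is maximal if $I\subseteq J$ with $J$ a homogeneous ideal implies $J=I$ or $J=\mathcal{R}$. A graded ring is local if it admits a unique maximal homogeneous ideal. A $\mathbb{Z}$-graded ringed space is a pair $(|S|,\mathcal{O}_S)$ of a topological space and a sheaf of associative unital supercommutative $\mathbb{Z}$-graded rings on it; it is a $\mathbb{Z}$-graded locally ringed space if all stalks $\mathcal{O}_{S,x}$,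 $x\in|S|$, are local graded rings.
   Formalization: All formal series do not form a direct sum of homogeneous parts (e.g. the sum of w^k, |w|=2), so sections are taken to be the formal series in which only finitely many degrees occur, and the sheaf gluing axiom is stated for sections of one common degree. *)

theory Defs
  imports "HOL-Analysis.Analysis" "HOL-Algebra.Ideal" "HOL-Algebra.RingHom"
begin

section \<open>Graded rings\<close>

record 'a graded_ring = "'a ring" +
  component :: "int \<Rightarrow> 'a set"

text \<open>\<open>A\<close> is the internal direct sum of the additive subgroups \<open>C k\<close>, \<open>k \<in> \<int>\<close>.\<close>

definition graded_family :: "('a, 'm) ring_scheme \<Rightarrow> (int \<Rightarrow> 'a set) \<Rightarrow> (int \<Rightarrow> 'a) \<Rightarrow> bool" where
  "graded_family R C c \<longleftrightarrow> (\<forall>k. c k \<in> C k) \<and> finite {k. c k \<noteq> \<zero>\<^bsub>R\<^esub>}"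

definition family_sum :: "('a, 'm) ring_scheme \<Rightarrow> (int \<Rightarrow> 'a) \<Rightarrow> 'a" where
  "family_sum R c = (\<Oplus>\<^bsub>R\<^esub>k\<in>{k. c k \<noteq> \<zero>\<^bsub>R\<^esub>}. c k)"

definition internal_direct_sum ::
    "('a, 'm) ring_scheme \<Rightarrow> (int \<Rightarrow> 'a set) \<Rightarrow> 'a set \<Rightarrow> bool" where
  "internal_direct_sum R C A \<longleftrightarrow>
     (\<forall>k. additive_subgroup (C k) R) \<and>
     A = family_sum R ` {c. graded_family R C c} \<and>
     inj_on (family_sum R) {c. graded_family R C c}"

locale graded_ring = ring R for R :: "('a, 'm) graded_ring_scheme" (structure) +
  assumes direct_sum_components: "internal_direct_sum R (component R) (carrier R)"
    and component_mult:
      "\<lbrakk>a \<in> component R i; b \<in> component R j\<rbrakk> \<Longrightarrow> a \<otimes> b \<in> component R (i + j)"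

locale supercommutative_graded_ring = graded_ring +
  assumes supercommutative:
      "\<lbrakk>a \<in> component R i; b \<in> component R j\<rbrakk> \<Longrightarrow>
         a \<otimes> b = (if even (i * j) then b \<otimes> a else \<ominus> (b \<otimes> a))"

definition homogeneous_ideal :: "'a set \<Rightarrow> ('a, 'm) graded_ring_scheme \<Rightarrow> bool" where
  "homogeneous_ideal I R \<longleftrightarrow>
     ideal I R \<and> internal_direct_sum R (\<lambda>k. I \<inter> component R k) I"

definition maximal_homogeneous_ideal :: "'a set \<Rightarrow> ('a, 'm) graded_ring_scheme \<Rightarrow> bool" where
  "maximal_homogeneous_ideal I R \<longleftrightarrow>
     homogeneous_ideal I R \<and> I \<noteq> carrier R \<and>
     (\<forall>J. homogeneous_ideal J R \<and> I \<subseteq> J \<longrightarrow> J = I \<or> J = carrier R)"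

definition local_graded_ring :: "('a, 'm) graded_ring_scheme \<Rightarrow> bool" where
  "local_graded_ring R \<longleftrightarrow> graded_ring R \<and> (\<exists>!I. maximal_homogeneous_ideal I R)"


section \<open>Graded ringed spaces\<close>

record ('x, 's) presheaf =
  Sections :: "'x set \<Rightarrow> 's graded_ring"
  restriction :: "'x set \<Rightarrow> 'x set \<Rightarrow> 's \<Rightarrow> 's"

text \<open>\<open>restriction \<O> V W\<close> is the map from sections over \<open>V\<close> to sections over \<open>W \<subseteq> V\<close>.\<close>

locale graded_presheaf =
  fixes X :: "'x topology" and \<O> :: "('x, 's) presheaf"
  assumes sections_ring: "openin X V \<Longrightarrow> supercommutative_graded_ring (Sections \<O> V)"
    and restriction_hom: "\<lbrakk>openin X V; openin X W; W \<subseteq> V\<rbrakk> \<Longrightarrow>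
          restriction \<O> V W \<in> ring_hom (Sections \<O> V) (Sections \<O> W)"
    and restriction_degree: "\<lbrakk>openin X V; openin X W; W \<subseteq> V; s \<in> component (Sections \<O> V) k\<rbrakk> \<Longrightarrow>
          restriction \<O> V W s \<in> component (Sections \<O> W) k"
    and restriction_id: "\<lbrakk>openin X V; s \<in> carrier (Sections \<O> V)\<rbrakk> \<Longrightarrow> restriction \<O> V V s = s"
    and restriction_comp: "\<lbrakk>openin X V; openin X W; openin X Z; Z \<subseteq> W; W \<subseteq> V;
          s \<in> carrier (Sections \<O> V)\<rbrakk> \<Longrightarrow>
          restriction \<O> W Z (restriction \<O> V W s) = restriction \<O> V Z s"

text \<open>
  A sheaf with values in the category of graded rings. Limits in that category are formed degree by
  degree, so the sections to be glued are of one common degree; a compatible family of sections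
  over an infinite cover whose degrees are unbounded has no reason to glue to an element of the
  direct sum of the components.
\<close>

locale graded_ringed_space = graded_presheaf +
  assumes locality: "\<lbrakk>\<And>V. V \<in> \<V> \<Longrightarrow> openin X V;
          s \<in> carrier (Sections \<O> (\<Union>\<V>)); t \<in> carrier (Sections \<O> (\<Union>\<V>));
          \<And>V. V \<in> \<V> \<Longrightarrow> restriction \<O> (\<Union>\<V>) V s = restriction \<O> (\<Union>\<V>) V t\<rbrakk> \<Longrightarrow> s = t"
    and gluing: "\<lbrakk>\<And>V. V \<in> \<V> \<Longrightarrow> openin X V;
          \<And>V. V \<in> \<V> \<Longrightarrow> \<sigma> V \<in> component (Sections \<O> V) k;
          \<And>V W. \<lbrakk>V \<in> \<V>; W \<in> \<V>\<rbrakk> \<Longrightarrow>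
            restriction \<O> V (V \<inter> W) (\<sigma> V) = restriction \<O> W (V \<inter> W) (\<sigma> W)\<rbrakk> \<Longrightarrow>
          \<exists>s \<in> component (Sections \<O> (\<Union>\<V>)) k. \<forall>V\<in>\<V>. restriction \<O> (\<Union>\<V>) V s = \<sigma> V"

definition local_sections ::
    "'x topology \<Rightarrow> ('x, 's) presheaf \<Rightarrow> 'x \<Rightarrow> ('x set \<times> 's) set" where
  "local_sections X \<O> x = {(V, s). openin X V \<and> x \<in> V \<and> s \<in> carrier (Sections \<O> V)}"

definition germ_rel ::
    "'x topology \<Rightarrow> ('x, 's) presheaf \<Rightarrow> 'x \<Rightarrow> (('x set \<times> 's) \<times> ('x set \<times> 's)) set" where
  "germ_rel X \<O> x = {((V, s), (W, t)).
     (V, s) \<in> local_sections X \<O> x \<and> (W, t) \<in> local_sections X \<O> x \<and>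
     (\<exists>Z. openin X Z \<and> x \<in> Z \<and> Z \<subseteq> V \<inter> W \<and> restriction \<O> V Z s = restriction \<O> W Z t)}"

definition germ ::
    "'x topology \<Rightarrow> ('x, 's) presheaf \<Rightarrow> 'x \<Rightarrow> 'x set \<Rightarrow> 's \<Rightarrow> ('x set \<times> 's) set" where
  "germ X \<O> x V s = germ_rel X \<O> x `` {(V, s)}"

definition stalk ::
    "'x topology \<Rightarrow> ('x, 's) presheaf \<Rightarrow> 'x \<Rightarrow> ('x set \<times> 's) set graded_ring" where
  "stalk X \<O> x =
     \<lparr>carrier = local_sections X \<O> x // germ_rel X \<O> x,
      monoid.mult = (\<lambda>a b. \<Union>(V, s)\<in>a. \<Union>(W, t)\<in>b. germ X \<O> x (V \<inter> W)
        (restriction \<O> V (V \<inter> W) s \<otimes>\<^bsub>Sections \<O> (V \<inter> W)\<^esub> restriction \<O> W (V \<inter> W) t)),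
      one = germ X \<O> x (topspace X) \<one>\<^bsub>Sections \<O> (topspace X)\<^esub>,
      zero = germ X \<O> x (topspace X) \<zero>\<^bsub>Sections \<O> (topspace X)\<^esub>,
      add = (\<lambda>a b. \<Union>(V, s)\<in>a. \<Union>(W, t)\<in>b. germ X \<O> x (V \<inter> W)
        (restriction \<O> V (V \<inter> W) s \<oplus>\<^bsub>Sections \<O> (V \<inter> W)\<^esub> restriction \<O> W (V \<inter> W) t)),
      component = (\<lambda>k. {germ X \<O> x V s | V s.
        openin X V \<and> x \<in> V \<and> s \<in> component (Sections \<O> V) k})\<rparr>"

locale graded_locally_ringed_space = graded_ringed_space +
  assumes stalk_local: "x \<in> topspace X \<Longrightarrow> local_graded_ring (stalk X \<O> x)"


section \<open>Smooth functions\<close>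

text \<open>
  \<open>\<real>\<^sup>n\<close> is \<^term>\<open>Euclidean_space n\<close>: sequences vanishing from index \<open>n\<close> on. The case \<open>n = 0\<close>, a
  point, is included.
\<close>

definition partial_deriv :: "nat \<Rightarrow> ((nat \<Rightarrow> real) \<Rightarrow> real) \<Rightarrow> (nat \<Rightarrow> real) \<Rightarrow> real" where
  "partial_deriv i f x = deriv (\<lambda>t. f (x(i := t))) (x i)"

definition iterated_partial ::
    "nat list \<Rightarrow> ((nat \<Rightarrow> real) \<Rightarrow> real) \<Rightarrow> (nat \<Rightarrow> real) \<Rightarrow> real" where
  "iterated_partial is f = foldr partial_deriv is f"

text \<open>Smoothness on an open subset \<open>V\<close>: all iterated partial derivatives exist and are continuous.\<close>

definition smooth_on :: "nat \<Rightarrow> (nat \<Rightarrow> real) set \<Rightarrow> ((nat \<Rightarrow> real) \<Rightarrow> real) \<Rightarrow> bool" where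
  "smooth_on n V f \<longleftrightarrow> (\<forall>is. set is \<subseteq> {..<n} \<longrightarrow>
     continuous_map (subtopology (Euclidean_space n) V) euclideanreal (iterated_partial is f) \<and>
     (\<forall>i<n. \<forall>x\<in>V. (\<lambda>t. iterated_partial is f (x(i := t))) differentiable at (x i)))"

definition smooth_functions :: "nat \<Rightarrow> (nat \<Rightarrow> real) set \<Rightarrow> ((nat \<Rightarrow> real) \<Rightarrow> real) set" where
  "smooth_functions n V = {f \<in> extensional V. smooth_on n V f}"


section \<open>Graded domains\<close>

text \<open>
  A graded vector space \<open>W\<close> with \<open>dim W\<^sub>0 = 0\<close> and \<open>dim W\<^sub>j = p j\<close> for \<open>j \<noteq> 0\<close> enters through a
  graded basis \<open>(w\<^sub>\<alpha>)\<close>, indexed by \<open>\<alpha> \<in> B\<close> with \<open>B\<close> a linearly ordered set; \<open>d \<alpha>\<close> is the degree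
  of \<open>w\<^sub>\<alpha>\<close>.
\<close>

definition graded_basis :: "(int \<Rightarrow> nat) \<Rightarrow> 'b set \<Rightarrow> ('b \<Rightarrow> int) \<Rightarrow> bool" where
  "graded_basis p B d \<longleftrightarrow>
     {\<alpha> \<in> B. d \<alpha> = 0} = {} \<and>
     (\<forall>j. j \<noteq> 0 \<longrightarrow> finite {\<alpha> \<in> B. d \<alpha> = j} \<and> card {\<alpha> \<in> B. d \<alpha> = j} = p j)"

text \<open>
  The monomial \<open>w\<^sub>\<alpha>\<^sub>1 \<cdots> w\<^sub>\<alpha>\<^sub>K\<close> with \<open>\<alpha>\<^sub>1 \<le> \<dots> \<le> \<alpha>\<^sub>K\<close> is the sorted word
  \<open>[\<alpha>\<^sub>1, \<dots>, \<alpha>\<^sub>K]\<close>; the empty word is the unit. Since \<open>w\<^sub>\<alpha> w\<^sub>\<alpha> = - w\<^sub>\<alpha> w\<^sub>\<alpha>\<close> for \<open>d \<alpha>\<close> odd, the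
  words in which some odd \<open>\<alpha>\<close> is repeated are the vanishing ones.
\<close>

definition monomials :: "'b::linorder set \<Rightarrow> ('b \<Rightarrow> int) \<Rightarrow> 'b list set" where
  "monomials B d = {m. sorted m \<and> set m \<subseteq> B \<and> (\<forall>\<alpha>. odd (d \<alpha>) \<longrightarrow> count_list m \<alpha> \<le> 1)}"

definition word_degree :: "('b \<Rightarrow> int) \<Rightarrow> 'b list \<Rightarrow> int" where
  "word_degree d m = sum_list (map d m)"

text \<open>
  The sign in \<open>w\<^sub>\<alpha>\<^sub>1 \<cdots> w\<^sub>\<alpha>\<^sub>K = \<plusminus> w\<^sub>\<beta>\<^sub>1 \<cdots> w\<^sub>\<beta>\<^sub>K\<close>, where \<open>\<beta>\<close> is \<open>\<alpha>\<close> sorted: by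
  \<open>u v = (-1)\<^bsup>|u||v|\<^esup> v u\<close>, each inversion between two odd factors contributes \<open>-1\<close>.
\<close>

definition koszul_sign :: "('b::linorder \<Rightarrow> int) \<Rightarrow> 'b list \<Rightarrow> real" where
  "koszul_sign d m = (-1) ^ card {(i, j). i < j \<and> j < length m \<and> m ! j < m ! i \<and>
     odd (d (m ! i)) \<and> odd (d (m ! j))}"

type_synonym 'b series = "'b list \<Rightarrow> (nat \<Rightarrow> real) \<Rightarrow> real"

definition formal_series ::
    "nat \<Rightarrow> 'b::linorder set \<Rightarrow> ('b \<Rightarrow> int) \<Rightarrow> (nat \<Rightarrow> real) set \<Rightarrow> 'b series set" where
  "formal_series n B d V = (monomials B d \<rightarrow>\<^sub>E smooth_functions n V)"

definition series_degrees ::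
    "'b::linorder set \<Rightarrow> ('b \<Rightarrow> int) \<Rightarrow> (nat \<Rightarrow> real) set \<Rightarrow> 'b series \<Rightarrow> int set" where
  "series_degrees B d V f = word_degree d ` {m \<in> monomials B d. \<exists>x\<in>V. f m x \<noteq> 0}"

text \<open>
  Sections of degree \<open>k\<close> are all formal series in the monomials of degree \<open>k\<close>. The graded ring of
  sections is the direct sum of these, that is, it consists of the formal series in which only
  finitely many degrees occur (each possibly with infinitely many monomials). The set of all formal
  series is in general a product rather than a direct sum of its homogeneous parts: consider
  \<open>\<Sum>k. w\<^sup>k\<close> with \<open>w\<close> of degree \<open>2\<close>.

  In a product only finitely many pairs of monomials contribute to a given coefficient; pairs
  whose product repeats an odd generator contribute to none.
\<close>

definition domain_ring ::
    "nat \<Rightarrow> 'b::linorder set \<Rightarrow> ('b \<Rightarrow> int) \<Rightarrow> (nat \<Rightarrow> real) set \<Rightarrow> 'b series graded_ring" where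
  "domain_ring n B d V =
     \<lparr>carrier = {f \<in> formal_series n B d V. finite (series_degrees B d V f)},
      monoid.mult = (\<lambda>f g. \<lambda>m\<in>monomials B d. \<lambda>x\<in>V.
        \<Sum>(u, v)\<in>{(u, v). u \<in> monomials B d \<and> v \<in> monomials B d \<and> sort (u @ v) = m}.
          koszul_sign d (u @ v) * f u x * g v x),
      one = (\<lambda>m\<in>monomials B d. \<lambda>x\<in>V. if m = [] then 1 else 0),
      zero = (\<lambda>m\<in>monomials B d. \<lambda>x\<in>V. 0),
      add = (\<lambda>f g. \<lambda>m\<in>monomials B d. \<lambda>x\<in>V. f m x + g m x),
      component = (\<lambda>k. {f \<in> formal_series n B d V. series_degrees B d V f \<subseteq> {k}})\<rparr>"

definition domain_sheaf ::
    "nat \<Rightarrow> 'b::linorder set \<Rightarrow> ('b \<Rightarrow> int) \<Rightarrow> (nat \<Rightarrow> real, 'b series) presheaf" where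
  "domain_sheaf n B d =
     \<lparr>Sections = domain_ring n B d,
      restriction = (\<lambda>V V' f. \<lambda>m\<in>monomials B d. restrict (f m) V')\<rparr>"

end

theory Submission
  imports Defs "HOL-Algebra.UnivPoly"
begin

text \<open>
  Three things have to be shown: the sections over an open set form a supercommutative graded ring,
  they form a sheaf, and the stalks are local graded rings.

  The first point is a matter of signs. The Koszul sign of a word counts inversions between odd
  letters. The inversions of a concatenation split into those inside each factor and those between the
  factors (\<open>koszul_sign_append\<close>), and the latter depend only on the letters that occur. Associativity
  and supercommutativity of the product of formal series follow by comparing the summands for each
  factorization of a monomial. Smoothness of the coefficients is preserved because each coefficient of
  a product is a finite sum of products of smooth functions.

  For the sheaf property, smoothness is local and sections are determined by their values, so
  compatible sections of one degree glue coefficientwise (\<open>glue_components\<close>).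

  The stalk at \<open>x\<close> is a graded ring for general reasons: finitely many germs live on a common
  neighbourhood, and only finitely many germs enter each axiom (\<open>graded_ring_stalk\<close>). Its maximal
  homogeneous ideal is the kernel of the evaluation at \<open>x\<close> of the constant term. By
  \<open>local_graded_ringI\<close> it suffices that homogeneous germs outside this ideal are invertible. The empty
  word has degree \<open>0\<close>, so such a germ has degree \<open>0\<close>, and its constant term is nonzero on a
  neighbourhood of \<open>x\<close>. There the coefficients of the inverse are found by recursion on the length of
  the monomial (\<open>reciprocal\<close>, \<open>degree_zero_invertible\<close>): although the part of positive length need not
  be nilpotent, each monomial has only finitely many factorizations. The inverse is again of degree
  \<open>0\<close>, so it belongs to the ring of sections, in which only finitely many degrees may occur.
\<close>

section \<open>Smooth functions\<close>

lemma Euclidean_space_eq: "Euclidean_space n = top_of_set {x. \<forall>i\<ge>n. x i = 0}"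
  by (simp add: Euclidean_space_def euclidean_product_topology)

lemma subtopology_Euclidean_space:
  assumes "openin (Euclidean_space n) V"
  shows "subtopology (Euclidean_space n) V = top_of_set V"
  using assms openin_subset[OF assms]
  by (simp add: Euclidean_space_eq subtopology_subtopology inf_absorb2)

text \<open>
  Moving one of the first \<open>n\<close> coordinates stays in \<open>V\<close> for a short time. Hence a partial derivative at
  a point of \<open>V\<close> sees only the values on \<open>V\<close>, and the value \<^term>\<open>undefined\<close> that a section takes outside
  \<open>V\<close> does no harm.
\<close>

lemma eventually_line_in_open:
  assumes V: "openin (Euclidean_space n) V" and x: "x \<in> V" and i: "i < n"
  shows "eventually (\<lambda>t. x(i := t) \<in> V) (nhds (x i))"
proof -
  let ?E = "{x::nat \<Rightarrow> real. \<forall>i\<ge>n. x i = 0}"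
  obtain T where T: "open T" "V = ?E \<inter> T"
    using V by (auto simp: Euclidean_space_eq openin_open)
  have "continuous_on UNIV (\<lambda>t. x(i := t))"
  proof (rule continuous_on_coordinatewise_then_product)
    show "continuous_on UNIV (\<lambda>t. (x(i := t)) j)" for j
      by (cases "j = i") (auto intro: continuous_intros)
  qed
  then have "open ((\<lambda>t. x(i := t)) -` T)"
    using T(1) by (simp add: open_vimage)
  moreover have "x i \<in> (\<lambda>t. x(i := t)) -` T" using x T by simp
  moreover have "x(i := t) \<in> ?E" for t using x T i by auto
  ultimately show ?thesis
    unfolding eventually_nhds T(2) by (intro exI[of _ "(\<lambda>t. x(i := t)) -` T"]) blast
qed

text \<open>
  Smoothness quantifies over all lists of derivatives at once. Cutting it at order \<open>k\<close> and taking off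
  one derivative at a time makes induction on \<open>k\<close> possible; the induction has to range over all
  functions, since the partial derivatives of a product or a quotient are again products of other
  functions.
\<close>

fun Ck_on :: "nat \<Rightarrow> nat \<Rightarrow> (nat \<Rightarrow> real) set \<Rightarrow> ((nat \<Rightarrow> real) \<Rightarrow> real) \<Rightarrow> bool" where
  "Ck_on 0 n V f \<longleftrightarrow> continuous_on V f"
| "Ck_on (Suc k) n V f \<longleftrightarrow> continuous_on V f \<and>
     (\<forall>i<n. (\<forall>x\<in>V. (\<lambda>t. f (x(i := t))) differentiable at (x i)) \<and> Ck_on k n V (partial_deriv i f))"

lemma Ck_on_continuous: "Ck_on k n V f \<Longrightarrow> continuous_on V f"
  by (cases k) auto

lemma Ck_on_lower: "Ck_on (Suc k) n V f \<Longrightarrow> Ck_on k n V f"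
  by (induction k arbitrary: f) auto

lemma iterated_partial_snoc:
  "iterated_partial (is @ [i]) f = iterated_partial is (partial_deriv i f)"
  by (simp add: iterated_partial_def)

lemma smooth_on_partial_deriv:
  assumes "smooth_on n V f" "i < n"
  shows "smooth_on n V (partial_deriv i f)"
  unfolding smooth_on_def
proof (intro allI impI)
  fix js assume "set js \<subseteq> {..<n}"
  then have "set (js @ [i]) \<subseteq> {..<n}" using assms(2) by auto
  then show "continuous_map (subtopology (Euclidean_space n) V) euclideanreal (iterated_partial js (partial_deriv i f)) \<and>
      (\<forall>j<n. \<forall>x\<in>V. (\<lambda>t. iterated_partial js (partial_deriv i f) (x(j := t))) differentiable at (x j))"
    using assms(1) unfolding smooth_on_def iterated_partial_snoc[symmetric] by blast
qed

lemma smooth_on_iff_Ck_on: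
  assumes V: "openin (Euclidean_space n) V"
  shows "smooth_on n V f \<longleftrightarrow> (\<forall>k. Ck_on k n V f)"
proof
  assume f: "smooth_on n V f"
  have base: "continuous_on V g \<and> (\<forall>i<n. \<forall>x\<in>V. (\<lambda>t. g (x(i := t))) differentiable at (x i))"
    if "smooth_on n V g" for g
    using spec[OF that[unfolded smooth_on_def], of "[]"]
    by (simp add: iterated_partial_def subtopology_Euclidean_space[OF V])
  have "Ck_on k n V f" for k
    using f by (induction k arbitrary: f) (use base smooth_on_partial_deriv in auto)
  then show "\<forall>k. Ck_on k n V f" ..
next
  assume f: "\<forall>k. Ck_on k n V f"
  have "\<forall>k. Ck_on k n V (iterated_partial is f)" if "set is \<subseteq> {..<n}" for "is"
    using that f
  proof (induction "is" arbitrary: f rule: rev_induct)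
    case (snoc i "is")
    have "\<forall>k. Ck_on k n V (partial_deriv i f)"
    proof
      fix k
      have "Ck_on (Suc k) n V f" "i < n" using snoc.prems by auto
      then show "Ck_on k n V (partial_deriv i f)" by simp
    qed
    then show ?case using snoc by (simp add: iterated_partial_snoc)
  qed (simp add: iterated_partial_def)
  then show "smooth_on n V f"
    unfolding smooth_on_def subtopology_Euclidean_space[OF V] continuous_map_iff_continuous
    using Ck_on.simps by blast
qed

lemma differentiable_line_cong:
  assumes V: "openin (Euclidean_space n) V" and fg: "\<And>y. y \<in> V \<Longrightarrow> f y = g y"
    and x: "x \<in> V" "i < n"
  shows "(\<lambda>t. f (x(i := t))) differentiable at (x i) \<longleftrightarrow> (\<lambda>t. g (x(i := t))) differentiable at (x i)"
    and "partial_deriv i f x = partial_deriv i g x"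
proof -
  have ev: "eventually (\<lambda>t. f (x(i := t)) = g (x(i := t))) (nhds (x i))"
    using eventually_line_in_open[OF V x] by eventually_elim (rule fg)
  show "(\<lambda>t. f (x(i := t))) differentiable at (x i) \<longleftrightarrow> (\<lambda>t. g (x(i := t))) differentiable at (x i)"
    unfolding real_differentiable_def
    using DERIV_cong_ev[OF refl ev refl] by blast
  show "partial_deriv i f x = partial_deriv i g x"
    unfolding partial_deriv_def using ev by (rule deriv_cong_ev) simp
qed

lemma Ck_on_cong:
  assumes V: "openin (Euclidean_space n) V" and "\<And>y. y \<in> V \<Longrightarrow> f y = g y"
  shows "Ck_on k n V f \<longleftrightarrow> Ck_on k n V g"
  using assms(2)
proof (induction k arbitrary: f g)
  case (Suc k)
  have "Ck_on k n V (partial_deriv i f) \<longleftrightarrow> Ck_on k n V (partial_deriv i g)" if "i < n" for i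
    using differentiable_line_cong(2)[OF V Suc.prems] that by (intro Suc.IH) auto
  moreover have "continuous_on V f \<longleftrightarrow> continuous_on V g"
    by (intro continuous_on_cong Suc.prems) auto
  moreover have "(\<lambda>t. f (x(i := t))) differentiable at (x i) \<longleftrightarrow> (\<lambda>t. g (x(i := t))) differentiable at (x i)"
    if "x \<in> V" "i < n" for x i
    using Suc.prems that by (rule differentiable_line_cong(1)[OF V])
  ultimately show ?case by simp
next
  case 0
  then show ?case by (simp cong: continuous_on_cong_simp)
qed

lemma Ck_on_subset: "Ck_on k n V f \<Longrightarrow> W \<subseteq> V \<Longrightarrow> Ck_on k n W f"
  by (induction k arbitrary: f) (auto intro: continuous_on_subset)

text \<open>
  Near a point of an open part the two punctured neighbourhood filters agree, so continuity there is
  continuity on the whole.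
\<close>

lemma Ck_on_local:
  assumes S: "openin (Euclidean_space n) S"
    and "\<And>x. x \<in> S \<Longrightarrow> \<exists>V. openin (Euclidean_space n) V \<and> x \<in> V \<and> V \<subseteq> S \<and> Ck_on k n V f"
  shows "Ck_on k n S f"
  using assms(2)
proof (induction k arbitrary: f)
  case 0
  show ?case
    unfolding Ck_on.simps continuous_on_eq_continuous_within
  proof
    fix x assume x: "x \<in> S"
    obtain V where V: "openin (Euclidean_space n) V" "x \<in> V" "V \<subseteq> S" "continuous_on V f"
      using 0[OF x] by auto
    obtain T where T: "open T" "V = {x. \<forall>i\<ge>n. x i = 0} \<inter> T"
      using V(1) by (auto simp: Euclidean_space_eq openin_open)
    have "S \<subseteq> {x. \<forall>i\<ge>n. x i = 0}" using openin_subset[OF S] by (simp add: Euclidean_space_eq)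
    then have "at x within S = at x within V"
      using T V by (intro at_within_nhd[of x T]) auto
    then show "continuous (at x within S) f"
      using V by (simp add: continuous_on_eq_continuous_within)
  qed
next
  case (Suc k)
  have loc: "\<exists>V. openin (Euclidean_space n) V \<and> x \<in> V \<and> V \<subseteq> S \<and> Ck_on k n V f \<and>
      (\<forall>i<n. (\<lambda>t. f (x(i := t))) differentiable at (x i) \<and> Ck_on k n V (partial_deriv i f))"
    if x: "x \<in> S" for x
  proof -
    obtain V where V: "openin (Euclidean_space n) V" "x \<in> V" "V \<subseteq> S" "Ck_on (Suc k) n V f"
      using Suc.prems[OF x] by blast
    show ?thesis
      by (rule exI[of _ V]) (use V Ck_on_lower[OF V(4)] in simp)
  qed
  have "Ck_on k n S f"
  proof (rule Suc.IH)
    fix x assume "x \<in> S"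
    from loc[OF this] show "\<exists>V. openin (Euclidean_space n) V \<and> x \<in> V \<and> V \<subseteq> S \<and> Ck_on k n V f"
      by (elim exE, intro exI, elim conjE, intro conjI)
  qed
  moreover have "Ck_on k n S (partial_deriv i f)" if "i < n" for i
  proof (rule Suc.IH)
    fix x assume "x \<in> S"
    then obtain V where V: "openin (Euclidean_space n) V" "x \<in> V" "V \<subseteq> S"
        "\<forall>i<n. (\<lambda>t. f (x(i := t))) differentiable at (x i) \<and> Ck_on k n V (partial_deriv i f)"
      using loc by blast
    from V(4) that have "Ck_on k n V (partial_deriv i f)" by blast
    with V(1-3) show "\<exists>V. openin (Euclidean_space n) V \<and> x \<in> V \<and> V \<subseteq> S \<and> Ck_on k n V (partial_deriv i f)"
      by (intro exI conjI)
  qed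
  moreover have "(\<lambda>t. f (x(i := t))) differentiable at (x i)" if "i < n" "x \<in> S" for i x
    using loc[OF that(2)] that(1) by (elim exE) simp
  ultimately show ?case using Ck_on_continuous by simp
qed

lemma has_derivative_line:
  assumes "(\<lambda>t. f (x(i := t))) differentiable at (x i)"
  shows "((\<lambda>t. f (x(i := t))) has_real_derivative partial_deriv i f x) (at (x i))"
  using assms unfolding partial_deriv_def
  by (simp add: DERIV_deriv_iff_real_differentiable)

lemma Ck_on_const: "Ck_on k n V (\<lambda>x. c)"
proof (induction k arbitrary: c)
  case (Suc k)
  have "partial_deriv i (\<lambda>x. c) = (\<lambda>x. 0)" for i :: nat
    by (simp add: partial_deriv_def fun_eq_iff)
  then show ?case using Suc by simp
qed simp

lemma Ck_on_add:
  assumes V: "openin (Euclidean_space n) V"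
  shows "Ck_on k n V f \<Longrightarrow> Ck_on k n V g \<Longrightarrow> Ck_on k n V (\<lambda>x. f x + g x)"
proof (induction k arbitrary: f g)
  case (Suc k)
  have "Ck_on k n V (partial_deriv i (\<lambda>x. f x + g x))" if "i < n" for i
  proof -
    have "partial_deriv i (\<lambda>x. f x + g x) x = partial_deriv i f x + partial_deriv i g x" if "x \<in> V" for x
      unfolding partial_deriv_def[of i "\<lambda>x. f x + g x"]
      by (intro DERIV_imp_deriv DERIV_add has_derivative_line)
         (use that \<open>i < n\<close> Suc.prems in auto)
    moreover have "Ck_on k n V (\<lambda>x. partial_deriv i f x + partial_deriv i g x)"
      by (rule Suc.IH) (use Suc.prems that in auto)
    ultimately show ?thesis by (rule iffD2[OF Ck_on_cong[OF V]])
  qed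
  moreover have "(\<lambda>t. f (x(i := t)) + g (x(i := t))) differentiable at (x i)" if "i < n" "x \<in> V" for i x
    by (intro differentiable_add) (use Suc.prems that in auto)
  moreover have "continuous_on V (\<lambda>x. f x + g x)"
    by (intro continuous_on_add) (use Suc.prems in auto)
  ultimately show ?case by simp
qed (simp add: continuous_on_add)

lemma Ck_on_mult:
  assumes V: "openin (Euclidean_space n) V"
  shows "Ck_on k n V f \<Longrightarrow> Ck_on k n V g \<Longrightarrow> Ck_on k n V (\<lambda>x. f x * g x)"
proof (induction k arbitrary: f g)
  case (Suc k)
  have "Ck_on k n V (partial_deriv i (\<lambda>x. f x * g x))" if "i < n" for i
  proof -
    have "partial_deriv i (\<lambda>x. f x * g x) x = partial_deriv i f x * g x + partial_deriv i g x * f x"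
      if "x \<in> V" for x
    proof -
      have "((\<lambda>t. f (x(i := t)) * g (x(i := t))) has_real_derivative
          partial_deriv i f x * g (x(i := x i)) + partial_deriv i g x * f (x(i := x i))) (at (x i))"
        by (intro DERIV_mult has_derivative_line) (use that \<open>i < n\<close> Suc.prems in auto)
      then show ?thesis
        unfolding partial_deriv_def[of i "\<lambda>x. f x * g x"] by (simp add: DERIV_imp_deriv)
    qed
    moreover have "Ck_on k n V (\<lambda>x. partial_deriv i f x * g x + partial_deriv i g x * f x)"
      by (intro Ck_on_add[OF V] Suc.IH) (use that Suc.prems Ck_on_lower in auto)
    ultimately show ?thesis by (rule iffD2[OF Ck_on_cong[OF V]])
  qed
  moreover have "(\<lambda>t. f (x(i := t)) * g (x(i := t))) differentiable at (x i)" if "i < n" "x \<in> V" for i x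
    by (intro differentiable_mult) (use Suc.prems that in auto)
  moreover have "continuous_on V (\<lambda>x. f x * g x)"
    by (intro continuous_on_mult) (use Suc.prems in auto)
  ultimately show ?case by simp
qed (simp add: continuous_on_mult)

text \<open>
  The derivative \<open>- f' / f\<^sup>2\<close> of \<open>1 / f\<close> contains \<open>1 / f\<close> itself undifferentiated, which the
  induction hypothesis controls one order lower.
\<close>

lemma Ck_on_inverse:
  assumes V: "openin (Euclidean_space n) V" and nz: "\<And>x. x \<in> V \<Longrightarrow> f x \<noteq> 0"
  shows "Ck_on k n V f \<Longrightarrow> Ck_on k n V (\<lambda>x. inverse (f x))"
proof (induction k)
  case (Suc k)
  have "Ck_on k n V (partial_deriv i (\<lambda>x. inverse (f x)))" if "i < n" for i
  proof -
    have "partial_deriv i (\<lambda>x. inverse (f x)) x = -1 * (inverse (f x) * partial_deriv i f x * inverse (f x))"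
      if "x \<in> V" for x
    proof -
      have "((\<lambda>t. inverse (f (x(i := t)))) has_real_derivative
          - (inverse (f (x(i := x i))) * partial_deriv i f x * inverse (f (x(i := x i))))) (at (x i))"
        by (intro DERIV_inverse' has_derivative_line) (use that \<open>i < n\<close> Suc.prems nz in auto)
      then show ?thesis
        unfolding partial_deriv_def[of i "\<lambda>x. inverse (f x)"] by (simp add: DERIV_imp_deriv)
    qed
    moreover have "Ck_on k n V (\<lambda>x. -1 * (inverse (f x) * partial_deriv i f x * inverse (f x)))"
      by (intro Ck_on_mult[OF V] Suc.IH Ck_on_const) (use that Suc.prems Ck_on_lower in auto)
    ultimately show ?thesis by (rule iffD2[OF Ck_on_cong[OF V]])
  qed
  moreover have "(\<lambda>t. inverse (f (x(i := t)))) differentiable at (x i)" if "i < n" "x \<in> V" for i x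
    by (intro differentiable_inverse) (use Suc.prems that nz in auto)
  moreover have "continuous_on V (\<lambda>x. inverse (f x))"
    by (intro continuous_on_inverse) (use Suc.prems nz in auto)
  ultimately show ?case by simp
qed (simp add: continuous_on_inverse nz)

lemma smooth_on_const: "openin (Euclidean_space n) V \<Longrightarrow> smooth_on n V (\<lambda>x. c)"
  by (simp add: smooth_on_iff_Ck_on Ck_on_const)

lemma smooth_on_add:
  "openin (Euclidean_space n) V \<Longrightarrow> smooth_on n V f \<Longrightarrow> smooth_on n V g \<Longrightarrow> smooth_on n V (\<lambda>x. f x + g x)"
  by (simp add: smooth_on_iff_Ck_on Ck_on_add)

lemma smooth_on_mult:
  "openin (Euclidean_space n) V \<Longrightarrow> smooth_on n V f \<Longrightarrow> smooth_on n V g \<Longrightarrow> smooth_on n V (\<lambda>x. f x * g x)"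
  by (simp add: smooth_on_iff_Ck_on Ck_on_mult)

lemma smooth_on_inverse:
  "openin (Euclidean_space n) V \<Longrightarrow> smooth_on n V f \<Longrightarrow> (\<And>x. x \<in> V \<Longrightarrow> f x \<noteq> 0) \<Longrightarrow>
    smooth_on n V (\<lambda>x. inverse (f x))"
  by (simp add: smooth_on_iff_Ck_on Ck_on_inverse)

lemma smooth_on_sum:
  assumes V: "openin (Euclidean_space n) V" and "\<And>a. a \<in> A \<Longrightarrow> smooth_on n V (f a)"
  shows "smooth_on n V (\<lambda>x. \<Sum>a\<in>A. f a x)"
  using assms(2)
  by (induction A rule: infinite_finite_induct) (auto intro: smooth_on_const smooth_on_add V)

lemma smooth_on_cong:
  "openin (Euclidean_space n) V \<Longrightarrow> (\<And>x. x \<in> V \<Longrightarrow> f x = g x) \<Longrightarrow> smooth_on n V f \<longleftrightarrow> smooth_on n V g"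
  using Ck_on_cong[of n V f g] by (simp add: smooth_on_iff_Ck_on)

lemma smooth_on_subset:
  "openin (Euclidean_space n) V \<Longrightarrow> openin (Euclidean_space n) W \<Longrightarrow> W \<subseteq> V \<Longrightarrow>
    smooth_on n V f \<Longrightarrow> smooth_on n W f"
  by (simp add: smooth_on_iff_Ck_on Ck_on_subset[of _ n V f W])

lemma smooth_on_local:
  assumes "openin (Euclidean_space n) S"
    and "\<And>x. x \<in> S \<Longrightarrow> \<exists>V. openin (Euclidean_space n) V \<and> x \<in> V \<and> V \<subseteq> S \<and> smooth_on n V f"
  shows "smooth_on n S f"
proof -
  have "Ck_on k n S f" for k
  proof (rule Ck_on_local[OF assms(1)])
    fix x assume "x \<in> S"
    then obtain V where V: "openin (Euclidean_space n) V" "x \<in> V" "V \<subseteq> S" "smooth_on n V f"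
      using assms(2) by blast
    from V(4) have "Ck_on k n V f" by (simp add: smooth_on_iff_Ck_on[OF V(1)])
    with V(1-3) show "\<exists>V. openin (Euclidean_space n) V \<and> x \<in> V \<and> V \<subseteq> S \<and> Ck_on k n V f"
      by (intro exI conjI)
  qed
  then show ?thesis by (simp add: smooth_on_iff_Ck_on[OF assms(1)])
qed

lemma smooth_on_continuous:
  "openin (Euclidean_space n) V \<Longrightarrow> smooth_on n V f \<Longrightarrow> continuous_on V f"
  by (simp add: smooth_on_iff_Ck_on Ck_on_continuous[of 0 n V f])


section \<open>Signs of reorderings\<close>

text \<open>
  The sign contributed by the inversions between two adjacent blocks of a word. The order of the
  letters inside each block is irrelevant to it, hence the multisets.
\<close>

definition crossing_sign :: "('b::linorder \<Rightarrow> int) \<Rightarrow> 'b multiset \<Rightarrow> 'b multiset \<Rightarrow> real" where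
  "crossing_sign d M N =
     (\<Prod>a\<in>#M. \<Prod>b\<in>#N. if b < a \<and> odd (d a) \<and> odd (d b) then -1 else 1)"

lemma crossing_sign_union:
  "crossing_sign d (M + M') N = crossing_sign d M N * crossing_sign d M' N"
  "crossing_sign d M (N + N') = crossing_sign d M N * crossing_sign d M N'"
  by (simp_all add: crossing_sign_def prod_mset.distrib)

lemma crossing_sign_empty [simp]: "crossing_sign d {#} N = 1" "crossing_sign d M {#} = 1"
  by (simp_all add: crossing_sign_def)

lemma crossing_sign_singleton:
  "crossing_sign d {#a#} (mset m) = (-1) ^ card {j. j < length m \<and> m ! j < a \<and> odd (d a) \<and> odd (d (m ! j))}"
proof (induction m)
  case (Cons b m)
  let ?P = "\<lambda>c. c < a \<and> odd (d a) \<and> odd (d c)"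
  have "{j. j < length (b # m) \<and> ?P ((b # m) ! j)}
      = (if ?P b then {0} else {}) \<union> Suc ` {j. j < length m \<and> ?P (m ! j)}"
    by (auto simp: less_Suc_eq_0_disj split: if_splits)
  also have "card \<dots> = (if ?P b then 1 else 0) + card {j. j < length m \<and> ?P (m ! j)}"
    by (subst card_Un_disjoint) (auto simp: card_image)
  finally show ?case
    using Cons by (simp add: crossing_sign_def)
qed simp

lemma koszul_sign_Cons:
  "koszul_sign d (a # m) = crossing_sign d {#a#} (mset m) * koszul_sign d m"
proof -
  let ?inv = "\<lambda>m. {(i, j). i < j \<and> j < length m \<and> m ! j < m ! i \<and> odd (d (m ! i)) \<and> odd (d (m ! j))}"
  let ?first = "{j. j < length m \<and> m ! j < a \<and> odd (d a) \<and> odd (d (m ! j))}"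
  have fin: "finite (?inv m)" for m
    by (rule finite_subset[of _ "{..<length m} \<times> {..<length m}"]) auto
  have "?inv (a # m) = (\<lambda>j. (0, Suc j)) ` ?first \<union> map_prod Suc Suc ` ?inv m" (is "?L = ?R")
  proof
    show "?L \<subseteq> ?R"
    proof
      fix p assume "p \<in> ?L"
      then obtain i j where "p = (i, Suc j)" "i < Suc j" "(i, Suc j) \<in> ?L"
        by (cases p; cases "snd p") auto
      then show "p \<in> ?R" by (cases i) (auto simp: image_iff)
    qed
  qed auto
  moreover have "card ((\<lambda>j. (0, Suc j)) ` ?first \<union> map_prod Suc Suc ` ?inv m)
      = card ((\<lambda>j. (0::nat, Suc j)) ` ?first) + card (map_prod Suc Suc ` ?inv m)"
    using fin[of m] by (intro card_Un_disjoint) auto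
  moreover have "card ((\<lambda>j. (0::nat, Suc j)) ` ?first) = card ?first"
    by (intro card_image) (auto simp: inj_on_def)
  moreover have "card (map_prod Suc Suc ` ?inv m) = card (?inv m)"
    by (intro card_image) (auto simp: inj_on_def)
  ultimately show ?thesis
    by (simp add: koszul_sign_def crossing_sign_singleton power_add)
qed

text \<open>
  An inversion of \<open>u @ v\<close> lies inside \<open>u\<close>, inside \<open>v\<close>, or between the two.
\<close>

lemma koszul_sign_append:
  "koszul_sign d (u @ v) = koszul_sign d u * koszul_sign d v * crossing_sign d (mset u) (mset v)"
proof (induction u)
  case Nil
  have "koszul_sign d [] = 1" by (simp add: koszul_sign_def)
  then show ?case by simp
next
  case (Cons a u)
  have "crossing_sign d (mset (a # u)) (mset v) = crossing_sign d {#a#} (mset v) * crossing_sign d (mset u) (mset v)"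
    by (simp only: crossing_sign_union(1)[symmetric]) simp
  then show ?case
    using Cons by (simp add: koszul_sign_Cons crossing_sign_union)
qed

lemma koszul_sign_sorted: "sorted m \<Longrightarrow> koszul_sign d m = 1"
proof -
  assume "sorted m"
  then have "{(i, j). i < j \<and> j < length m \<and> m ! j < m ! i \<and> odd (d (m ! i)) \<and> odd (d (m ! j))} = {}"
    by (auto simp: sorted_iff_nth_mono_less) (meson leD less_trans)
  then show ?thesis unfolding koszul_sign_def by (simp only: card.empty power_0)
qed

text \<open>
  Sorting part of a word first removes exactly the inversions of that part and keeps the others. These
  two identities carry the associativity of the product of formal series.
\<close>

lemma koszul_sign_sort_append:
  "koszul_sign d (u @ v) * koszul_sign d (sort (u @ v) @ w) = koszul_sign d (u @ v @ w) "
  "koszul_sign d (v @ w) * koszul_sign d (u @ sort (v @ w)) = koszul_sign d (u @ v @ w)"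
  by (simp_all add: koszul_sign_append koszul_sign_sorted crossing_sign_union)

text \<open>
  A pair of odd letters, one from each block, is inverted in exactly one of the two orders of the
  blocks, unless the letters coincide; the hypothesis excludes this.
\<close>

lemma crossing_sign_swap:
  assumes "\<And>a. a \<in># M \<Longrightarrow> a \<in># N \<Longrightarrow> even (d a)"
  shows "crossing_sign d M N = (-1) ^ (size {#a \<in># M. odd (d a)#} * size {#b \<in># N. odd (d b)#}) * crossing_sign d N M"
  using assms
proof (induction M)
  case (add a M)
  have N: "crossing_sign d {#a#} N = (-1) ^ ((if odd (d a) then 1 else 0) * size {#b \<in># N. odd (d b)#}) * crossing_sign d N {#a#}"
    using add.prems
  proof (induction N)
    case (add b N)
    then have "odd (d a) \<Longrightarrow> odd (d b) \<Longrightarrow> a \<noteq> b" by auto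
    moreover have "crossing_sign d {#a#} N = (-1) ^ ((if odd (d a) then 1 else 0) * size {#b \<in># N. odd (d b)#}) * crossing_sign d N {#a#}"
      using add by auto
    ultimately show ?case
      by (cases a b rule: linorder_cases) (auto simp: crossing_sign_def)
  qed simp
  have "crossing_sign d (add_mset a M) N = crossing_sign d {#a#} N * crossing_sign d M N"
    by (simp only: crossing_sign_union(1)[symmetric]) simp
  moreover have "crossing_sign d N (add_mset a M) = crossing_sign d N {#a#} * crossing_sign d N M"
    by (simp only: crossing_sign_union(2)[symmetric]) simp
  ultimately show ?case
    using N add by (simp add: power_add algebra_simps)
qed simp

lemma even_word_degree: "even (word_degree d m) \<longleftrightarrow> even (size {#a \<in># mset m. odd (d a)#})"
  by (induction m) (auto simp: word_degree_def)

lemma word_degree_append: "word_degree d (u @ v) = word_degree d u + word_degree d v"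
  by (simp add: word_degree_def)

lemma word_degree_sort [simp]: "word_degree d (sort m) = word_degree d m"
proof -
  have "word_degree d m = (\<Sum>a\<in>#mset m. d a)" for m
    by (induction m) (auto simp: word_degree_def)
  then show ?thesis by simp
qed

section \<open>Factorizations of monomials\<close>

lemma monomials_Nil [simp]: "[] \<in> monomials B d"
  by (simp add: monomials_def)

lemma monomials_sorted: "m \<in> monomials B d \<Longrightarrow> sorted m"
  by (simp add: monomials_def)

lemma monomials_sort_iff:
  "sort m \<in> monomials B d \<longleftrightarrow> set m \<subseteq> B \<and> (\<forall>\<alpha>. odd (d \<alpha>) \<longrightarrow> count (mset m) \<alpha> \<le> 1)"
  by (simp add: monomials_def count_mset[symmetric])

text \<open>
  A factor of a nonvanishing monomial is itself nonvanishing.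
\<close>

lemma monomials_sort_appendD:
  assumes "sort (u @ v) \<in> monomials B d"
  shows "sort u \<in> monomials B d" "sort v \<in> monomials B d"
  using assms unfolding monomials_sort_iff by fastforce+

text \<open>
  The index set of the sum that defines the coefficient of \<open>m\<close> in a product.
\<close>

definition factorizations :: "'b::linorder set \<Rightarrow> ('b \<Rightarrow> int) \<Rightarrow> 'b list \<Rightarrow> ('b list \<times> 'b list) set" where
  "factorizations B d m = {(u, v). u \<in> monomials B d \<and> v \<in> monomials B d \<and> sort (u @ v) = m}"

lemma factorization_set: "(u, v) \<in> factorizations B d m \<Longrightarrow> set u \<union> set v = set m \<and> length u + length v = length m"
  unfolding factorizations_def by (auto dest!: arg_cong[of _ m set] simp flip: length_append)

lemma finite_factorizations [simp]: "finite (factorizations B d m)"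
proof (rule finite_subset)
  let ?W = "{w. set w \<subseteq> set m \<and> length w \<le> length m}"
  show "factorizations B d m \<subseteq> ?W \<times> ?W"
    using factorization_set[of _ _ B d m] by fastforce
  show "finite (?W \<times> ?W)"
    by (intro finite_cartesian_product finite_lists_length_le) auto
qed

text \<open>
  Both ways of bracketing enumerate the ordered factorizations of \<open>m\<close> into three monomials: the
  product of two adjacent factors is a nonvanishing monomial because \<open>m\<close> is one.
\<close>

lemma factorizations_of_factors:
  assumes m: "m \<in> monomials B d"
  shows "(\<Sum>(p, w)\<in>factorizations B d m. \<Sum>(u, v)\<in>factorizations B d p. h u v w)
       = (\<Sum>(u, v, w)\<in>{(u, v, w). u \<in> monomials B d \<and> v \<in> monomials B d \<and> w \<in> monomials B d \<and> sort (u @ v @ w) = m}. h u v w)"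
    (is "?L = sum _ ?T")
    and "(\<Sum>(u, p)\<in>factorizations B d m. \<Sum>(v, w)\<in>factorizations B d p. h u v w)
       = (\<Sum>(u, v, w)\<in>{(u, v, w). u \<in> monomials B d \<and> v \<in> monomials B d \<and> w \<in> monomials B d \<and> sort (u @ v @ w) = m}. h u v w)"
    (is "?R = _")
proof -
  have assoc: "sort (sort (u @ v) @ w) = sort (u @ v @ w)" "sort (u @ sort (v @ w)) = sort (u @ v @ w)" for u v w :: "'a list"
    by (auto intro!: properties_for_sort)
  have sub: "sort (u @ v) \<in> monomials B d" "sort (v @ w) \<in> monomials B d"
    if "sort (u @ v @ w) = m" for u v w
    using m that monomials_sort_appendD(1)[of "u @ v" w B d] monomials_sort_appendD(2)[of u "v @ w" B d] by auto
  have "?L = (\<Sum>((p, w), (u, v))\<in>(SIGMA q:factorizations B d m. factorizations B d (fst q)). h u v w)"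
    by (subst sum.Sigma[symmetric]) (auto simp: case_prod_unfold)
  also have "\<dots> = (\<Sum>(u, v, w)\<in>?T. h u v w)"
    by (rule sum.reindex_bij_witness[where i = "\<lambda>(u, v, w). ((sort (u @ v), w), (u, v))" and j = "\<lambda>((p, w), (u, v)). (u, v, w)"])
      (auto simp: factorizations_def assoc sub)
  finally show "?L = sum (\<lambda>(u, v, w). h u v w) ?T" .
  have "?R = (\<Sum>((u, p), (v, w))\<in>(SIGMA q:factorizations B d m. factorizations B d (snd q)). h u v w)"
    by (subst sum.Sigma[symmetric]) (auto simp: case_prod_unfold)
  also have "\<dots> = (\<Sum>(u, v, w)\<in>?T. h u v w)"
    by (rule sum.reindex_bij_witness[where i = "\<lambda>(u, v, w). ((u, sort (v @ w)), (v, w))" and j = "\<lambda>((u, p), (v, w)). (u, v, w)"])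
      (auto simp: factorizations_def assoc sub)
  finally show "?R = sum (\<lambda>(u, v, w). h u v w) ?T" .
qed

text \<open>
  For a nonvanishing product this is supercommutativity on monomials: modulo \<open>2\<close>, the degree of a
  monomial counts its odd letters.
\<close>

lemma koszul_sign_swap:
  assumes "sort (u @ v) \<in> monomials B d" "sorted u" "sorted v"
  shows "koszul_sign d (u @ v) = (if even (word_degree d u * word_degree d v) then 1 else -1) * koszul_sign d (v @ u)"
proof -
  have "even (d a)" if "a \<in># mset u" "a \<in># mset v" for a
  proof (rule ccontr)
    assume "odd (d a)"
    then have "count (mset (u @ v)) a \<le> 1" using assms(1) unfolding monomials_sort_iff by blast
    moreover have "count (mset u) a \<ge> 1" "count (mset v) a \<ge> 1" using that by simp_all
    ultimately show False by simp
  qed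
  from crossing_sign_swap[of "mset u" "mset v" d, OF this] show ?thesis
    using assms(2,3) by (simp add: koszul_sign_append koszul_sign_sorted even_word_degree uminus_power_if)
qed

section \<open>Graded rings with one maximal homogeneous ideal\<close>

lemma (in abelian_group) additive_subgroup_intro:
  assumes "H \<subseteq> carrier G" "\<zero> \<in> H" "\<And>a b. \<lbrakk>a \<in> H; b \<in> H\<rbrakk> \<Longrightarrow> a \<oplus> b \<in> H" "\<And>a. a \<in> H \<Longrightarrow> \<ominus> a \<in> H"
  shows "additive_subgroup H G"
  using assms
  by (intro additive_subgroup.intro subgroup.intro) (auto simp: a_inv_def[symmetric])

lemma (in abelian_group) finsum_in_subgroup:
  assumes "additive_subgroup H G" "\<And>k. k \<in> A \<Longrightarrow> c k \<in> H"
  shows "finsum G c A \<in> H"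
proof -
  interpret H: additive_subgroup H G by fact
  show ?thesis
    using assms(2)
  proof (induction A rule: infinite_finite_induct)
    case (insert k A)
    moreover have "c \<in> A \<rightarrow> carrier G" "c k \<in> carrier G" using insert.prems H.a_subset by auto
    ultimately show ?case by (simp add: finsum_insert)
  qed (simp_all add: finsum_infinite)
qed

lemma (in abelian_group) family_sum_superset:
  assumes "graded_family G C c" "\<And>k. C k \<subseteq> carrier G" "finite A" "{k. c k \<noteq> \<zero>} \<subseteq> A"
  shows "family_sum G c = finsum G c A"
  unfolding family_sum_def
  by (rule add.finprod_mono_neutral_cong_left) (use assms in \<open>auto simp: graded_family_def\<close>)

context graded_ring
begin

lemma component_subgroup: "additive_subgroup (component R k) R"
  using direct_sum_components by (simp add: internal_direct_sum_def)

lemma component_carrier: "component R k \<subseteq> carrier R"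
  by (rule additive_subgroup.a_subset[OF component_subgroup])

lemma homogeneous_decomposition:
  assumes "a \<in> carrier R"
  obtains c where "graded_family R (component R) c" "family_sum R c = a"
proof -
  have "carrier R = family_sum R ` {c. graded_family R (component R) c}"
    using direct_sum_components by (simp add: internal_direct_sum_def)
  then show ?thesis using assms that by auto
qed

text \<open>
  Uniqueness of decompositions is inherited from the ring, so only closure under homogeneous parts is
  at stake.
\<close>

lemma homogeneous_idealI:
  assumes I: "ideal I R"
    and comp: "\<And>c. \<lbrakk>graded_family R (component R) c; family_sum R c \<in> I\<rbrakk> \<Longrightarrow> \<forall>k. c k \<in> I"
  shows "homogeneous_ideal I R"
  unfolding homogeneous_ideal_def internal_direct_sum_def
proof (intro conjI allI)
  interpret I: ideal I R by fact
  show "additive_subgroup (I \<inter> component R k) R" for k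
  proof -
    interpret C: additive_subgroup "component R k" R by (rule component_subgroup)
    show ?thesis using C.a_subset by (intro additive_subgroup_intro) auto
  qed
  have mono: "graded_family R (component R) c" if "graded_family R (\<lambda>k. I \<inter> component R k) c" for c
    using that by (auto simp: graded_family_def)
  show "I = family_sum R ` {c. graded_family R (\<lambda>k. I \<inter> component R k) c}"
  proof
    show "I \<subseteq> family_sum R ` {c. graded_family R (\<lambda>k. I \<inter> component R k) c}"
    proof
      fix a assume a: "a \<in> I"
      then obtain c where c: "graded_family R (component R) c" "family_sum R c = a"
        using homogeneous_decomposition[of a] I.a_subset by blast
      then have "graded_family R (\<lambda>k. I \<inter> component R k) c"
        using comp[OF c(1)] a by (auto simp: graded_family_def)
      then show "a \<in> family_sum R ` {c. graded_family R (\<lambda>k. I \<inter> component R k) c}"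
        using c by blast
    qed
    show "family_sum R ` {c. graded_family R (\<lambda>k. I \<inter> component R k) c} \<subseteq> I"
      by (auto simp: family_sum_def graded_family_def intro!: finsum_in_subgroup I.additive_subgroup_axioms)
  qed
  show "inj_on (family_sum R) {c. graded_family R (\<lambda>k. I \<inter> component R k) c}"
    using direct_sum_components mono unfolding internal_direct_sum_def
    by (auto intro: inj_on_subset)
qed (fact I)

text \<open>
  A homogeneous ideal contains the homogeneous parts of its elements. If it is proper it contains no
  invertible element, so all these parts lie in \<open>I\<close>, and therefore the ideal is contained in \<open>I\<close>.
  Only homogeneous elements outside \<open>I\<close> have to be invertible, which is weaker than locality of the
  underlying ring.
\<close>

lemma local_graded_ringI:
  assumes I: "homogeneous_ideal I R" "I \<noteq> carrier R"
    and inv: "\<And>k a. \<lbrakk>a \<in> component R k; a \<notin> I\<rbrakk> \<Longrightarrow> \<exists>b\<in>carrier R. a \<otimes> b = \<one>"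
  shows "local_graded_ring R"
proof -
  interpret I: ideal I R using I(1) by (simp add: homogeneous_ideal_def)
  have proper: "J \<subseteq> I" if J: "homogeneous_ideal J R" "J \<noteq> carrier R" for J
  proof
    fix a assume "a \<in> J"
    interpret J: ideal J R using J(1) by (simp add: homogeneous_ideal_def)
    obtain c where c: "graded_family R (\<lambda>k. J \<inter> component R k) c" "family_sum R c = a"
    proof -
      have J_eq: "J = family_sum R ` {c. graded_family R (\<lambda>k. J \<inter> component R k) c}"
        using J(1) by (simp add: homogeneous_ideal_def internal_direct_sum_def)
      have "a \<in> family_sum R ` {c. graded_family R (\<lambda>k. J \<inter> component R k) c}"
        by (subst J_eq[symmetric]) (rule \<open>a \<in> J\<close>)
      then show thesis using that by blast
    qed
    have "c k \<in> I" for k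
    proof (rule ccontr)
      assume "c k \<notin> I"
      moreover have ck: "c k \<in> J" "c k \<in> component R k" using c(1) by (auto simp: graded_family_def)
      ultimately obtain b where "b \<in> carrier R" "c k \<otimes> b = \<one>" using inv by blast
      then have "\<one> \<in> J" using J.I_r_closed[OF ck(1), of b] by simp
      then show False using J.one_imp_carrier J(2) by blast
    qed
    then show "a \<in> I"
      unfolding c(2)[symmetric] family_sum_def
      by (intro finsum_in_subgroup I.additive_subgroup_axioms)
  qed
  have "maximal_homogeneous_ideal I R"
    using I proper unfolding maximal_homogeneous_ideal_def by blast
  moreover have "J = I" if "maximal_homogeneous_ideal J R" for J
    using that I proper[of J] unfolding maximal_homogeneous_ideal_def by blast
  ultimately show ?thesis
    unfolding local_graded_ring_def using graded_ring_axioms by blast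
qed

end

section \<open>The graded ring of sections of a graded domain\<close>

lemma factorizations_Nil [simp]: "factorizations B d [] = {([], [])}"
proof -
  have sort_Nil: "sort w = [] \<longleftrightarrow> w = []" for w :: "'a list"
    by (cases w) simp_all
  show ?thesis unfolding factorizations_def by (auto simp: sort_Nil)
qed

text \<open>
  Elements of the ring of sections over an open set \<open>V\<close> are compared coefficientwise and pointwise on
  \<open>V\<close>; outside the monomials and outside \<open>V\<close> all of them agree by extensionality.
\<close>

locale domain_sections =
  fixes n :: nat and B :: "'b::linorder set" and d :: "'b \<Rightarrow> int" and V :: "(nat \<Rightarrow> real) set"
  assumes open_V: "openin (Euclidean_space n) V"
begin

abbreviation "M \<equiv> monomials B d"
abbreviation "R \<equiv> domain_ring n B d V"

lemma formal_seriesI: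
  "(\<And>m. m \<in> M \<Longrightarrow> smooth_on n V (h m)) \<Longrightarrow> (\<lambda>m\<in>M. \<lambda>x\<in>V. h m x) \<in> formal_series n B d V"
  by (auto simp: formal_series_def smooth_functions_def smooth_on_cong[OF open_V, of "restrict (h m) V" "h m" for m])

lemma formal_series_smooth: "f \<in> formal_series n B d V \<Longrightarrow> m \<in> M \<Longrightarrow> smooth_on n V (f m)"
  by (auto simp: formal_series_def smooth_functions_def)

lemma formal_series_eqI:
  assumes "f \<in> formal_series n B d V" "g \<in> formal_series n B d V" "\<And>m x. m \<in> M \<Longrightarrow> x \<in> V \<Longrightarrow> f m x = g m x"
  shows "f = g"
proof (rule PiE_ext)
  show "f m = g m" if "m \<in> M" for m
    using assms that by (intro extensionalityI[of _ V]) (auto simp: formal_series_def smooth_functions_def PiE_def Pi_def)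
qed (use assms in \<open>auto simp: formal_series_def\<close>)

text \<open>
  A finite superset of the degrees is easier to exhibit for a sum or a product than the exact set.
\<close>

lemma series_degrees_subset_iff:
  "series_degrees B d V f \<subseteq> D \<longleftrightarrow> (\<forall>m\<in>M. \<forall>x\<in>V. f m x \<noteq> 0 \<longrightarrow> word_degree d m \<in> D)"
  by (auto simp: series_degrees_def)

lemma carrier_iff: "f \<in> carrier R \<longleftrightarrow> f \<in> formal_series n B d V \<and> finite (series_degrees B d V f)"
  by (simp add: domain_ring_def)

lemma component_iff:
  "f \<in> component R k \<longleftrightarrow> f \<in> formal_series n B d V \<and> (\<forall>m\<in>M. \<forall>x\<in>V. f m x \<noteq> 0 \<longrightarrow> word_degree d m = k)"
  using series_degrees_subset_iff[of f "{k}"] by (simp add: domain_ring_def)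

lemma component_subset_carrier: "component R k \<subseteq> carrier R"
  by (auto simp: domain_ring_def intro: finite_subset)

lemma carrier_eqI:
  "f \<in> carrier R \<Longrightarrow> g \<in> carrier R \<Longrightarrow> (\<And>m x. m \<in> M \<Longrightarrow> x \<in> V \<Longrightarrow> f m x = g m x) \<Longrightarrow> f = g"
  by (auto simp: carrier_iff intro: formal_series_eqI)

lemma carrierI:
  assumes "f \<in> formal_series n B d V" "finite D" "\<And>m x. \<lbrakk>m \<in> M; x \<in> V; f m x \<noteq> 0\<rbrakk> \<Longrightarrow> word_degree d m \<in> D"
  shows "f \<in> carrier R"
  using assms series_degrees_subset_iff[of f D] finite_subset[of "series_degrees B d V f" D]
  by (auto simp: carrier_iff)

lemma series_degreesI: "\<lbrakk>m \<in> M; x \<in> V; f m x \<noteq> 0\<rbrakk> \<Longrightarrow> word_degree d m \<in> series_degrees B d V f"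
  by (auto simp: series_degrees_def)

lemma carrier_smooth: "f \<in> carrier R \<Longrightarrow> m \<in> M \<Longrightarrow> smooth_on n V (f m)"
  by (simp add: carrier_iff formal_series_smooth)

lemma zero_apply: "m \<in> M \<Longrightarrow> x \<in> V \<Longrightarrow> \<zero>\<^bsub>R\<^esub> m x = 0"
  and one_apply: "m \<in> M \<Longrightarrow> x \<in> V \<Longrightarrow> \<one>\<^bsub>R\<^esub> m x = (if m = [] then 1 else 0)"
  and add_apply: "m \<in> M \<Longrightarrow> x \<in> V \<Longrightarrow> (f \<oplus>\<^bsub>R\<^esub> g) m x = f m x + g m x"
  and mult_apply: "m \<in> M \<Longrightarrow> x \<in> V \<Longrightarrow>
    (f \<otimes>\<^bsub>R\<^esub> g) m x = (\<Sum>(u, v)\<in>factorizations B d m. koszul_sign d (u @ v) * f u x * g v x)"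
  by (simp_all add: domain_ring_def factorizations_def)

lemma mult_nonzeroD:
  assumes "m \<in> M" "x \<in> V" "(f \<otimes>\<^bsub>R\<^esub> g) m x \<noteq> 0"
  obtains u v where "(u, v) \<in> factorizations B d m" "f u x \<noteq> 0" "g v x \<noteq> 0"
proof -
  obtain p where "p \<in> factorizations B d m" "(case p of (u, v) \<Rightarrow> koszul_sign d (u @ v) * f u x * g v x) \<noteq> 0"
    using assms(3) unfolding mult_apply[OF assms(1,2)] by (rule sum.not_neutral_contains_not_neutral)
  then show ?thesis using that by (cases p) auto
qed

lemma factorizationsD:
  assumes "(u, v) \<in> factorizations B d m"
  shows "u \<in> M" "v \<in> M" "word_degree d m = word_degree d u + word_degree d v"
  using assms by (auto simp: factorizations_def simp flip: word_degree_append)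

lemma zero_closed: "\<zero>\<^bsub>R\<^esub> \<in> carrier R"
proof (rule carrierI[of _ "{}"])
  show "\<zero>\<^bsub>R\<^esub> \<in> formal_series n B d V"
    unfolding domain_ring_def by (simp add: formal_seriesI smooth_on_const open_V)
qed (simp_all add: zero_apply)

lemma one_component: "\<one>\<^bsub>R\<^esub> \<in> component R 0"
proof -
  have "\<one>\<^bsub>R\<^esub> \<in> formal_series n B d V"
    unfolding domain_ring_def by (simp add: formal_seriesI smooth_on_const open_V)
  then show ?thesis by (simp add: component_iff one_apply word_degree_def)
qed

lemma add_series:
  assumes "f \<in> formal_series n B d V" "g \<in> formal_series n B d V"
  shows "f \<oplus>\<^bsub>R\<^esub> g \<in> formal_series n B d V"
  unfolding domain_ring_def using assms
  by (simp add: formal_seriesI smooth_on_add open_V formal_series_smooth)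

lemma mult_series:
  assumes "f \<in> formal_series n B d V" "g \<in> formal_series n B d V"
  shows "f \<otimes>\<^bsub>R\<^esub> g \<in> formal_series n B d V"
proof -
  have summand: "smooth_on n V (\<lambda>x. koszul_sign d (u @ v) * f u x * g v x)" if "(u, v) \<in> factorizations B d m" for u v m
    using factorizationsD(1,2)[OF that] assms
    by (intro smooth_on_mult[OF open_V, of "\<lambda>x. koszul_sign d (u @ v) * f u x" "g v"]
        smooth_on_mult[OF open_V, of "\<lambda>x. koszul_sign d (u @ v)" "f u"] smooth_on_const[OF open_V])
      (simp_all add: formal_series_smooth)
  have "smooth_on n V (\<lambda>x. \<Sum>p\<in>factorizations B d m. koszul_sign d (fst p @ snd p) * f (fst p) x * g (snd p) x)" for m
    by (rule smooth_on_sum[OF open_V]) (simp add: summand)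
  from formal_seriesI[OF this] show ?thesis
    by (simp add: domain_ring_def factorizations_def case_prod_unfold)
qed

lemma scale_series:
  assumes "f \<in> formal_series n B d V"
  shows "(\<lambda>m\<in>M. \<lambda>x\<in>V. c m * f m x) \<in> formal_series n B d V"
  by (intro formal_seriesI smooth_on_mult smooth_on_const open_V formal_series_smooth assms)

lemma add_closed:
  assumes "f \<in> carrier R" "g \<in> carrier R"
  shows "f \<oplus>\<^bsub>R\<^esub> g \<in> carrier R"
proof (rule carrierI[of _ "series_degrees B d V f \<union> series_degrees B d V g"])
  fix m x assume mx: "m \<in> M" "x \<in> V" "(f \<oplus>\<^bsub>R\<^esub> g) m x \<noteq> 0"
  then have "f m x \<noteq> 0 \<or> g m x \<noteq> 0" by (auto simp: add_apply)
  then show "word_degree d m \<in> series_degrees B d V f \<union> series_degrees B d V g"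
    using mx series_degreesI by blast
qed (use assms in \<open>auto simp: carrier_iff add_series\<close>)

lemma mult_closed:
  assumes "f \<in> carrier R" "g \<in> carrier R"
  shows "f \<otimes>\<^bsub>R\<^esub> g \<in> carrier R"
proof (rule carrierI[of _ "(\<lambda>(i, j). i + j) ` (series_degrees B d V f \<times> series_degrees B d V g)"])
  fix m x assume mx: "m \<in> M" "x \<in> V" and "(f \<otimes>\<^bsub>R\<^esub> g) m x \<noteq> 0"
  then obtain u v where uv: "(u, v) \<in> factorizations B d m" "f u x \<noteq> 0" "g v x \<noteq> 0"
    by (rule mult_nonzeroD)
  note deg = factorizationsD[OF uv(1)]
  have "word_degree d u \<in> series_degrees B d V f" "word_degree d v \<in> series_degrees B d V g"
    using series_degreesI deg(1,2) mx uv(2,3) by blast+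
  then show "word_degree d m \<in> (\<lambda>(i, j). i + j) ` (series_degrees B d V f \<times> series_degrees B d V g)"
    using deg(3) by force
qed (use assms in \<open>auto simp: carrier_iff mult_series\<close>)

lemma component_mult:
  assumes "f \<in> component R i" "g \<in> component R j"
  shows "f \<otimes>\<^bsub>R\<^esub> g \<in> component R (i + j)"
proof -
  have "word_degree d m = i + j" if "m \<in> M" "x \<in> V" "(f \<otimes>\<^bsub>R\<^esub> g) m x \<noteq> 0" for m x
    using that
  proof (rule mult_nonzeroD)
    fix u v assume uv: "(u, v) \<in> factorizations B d m" "f u x \<noteq> 0" "g v x \<noteq> 0"
    then have "word_degree d u = i" "word_degree d v = j"
      using factorizationsD(1,2)[OF uv(1)] assms that(2) unfolding component_iff by blast+
    then show ?thesis using factorizationsD(3)[OF uv(1)] by simp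
  qed
  then show ?thesis using assms mult_series by (simp add: component_iff)
qed

lemma scale_closed:
  assumes "f \<in> carrier R"
  shows "(\<lambda>m\<in>M. \<lambda>x\<in>V. c m * f m x) \<in> carrier R"
proof (rule carrierI)
  show "(\<lambda>m\<in>M. \<lambda>x\<in>V. c m * f m x) \<in> formal_series n B d V"
    using assms by (simp add: carrier_iff scale_series)
  show "finite (series_degrees B d V f)" using assms by (simp add: carrier_iff)
qed (auto simp: series_degrees_def)

lemma mult_assoc:
  assumes "f \<in> carrier R" "g \<in> carrier R" "h \<in> carrier R"
  shows "f \<otimes>\<^bsub>R\<^esub> g \<otimes>\<^bsub>R\<^esub> h = f \<otimes>\<^bsub>R\<^esub> (g \<otimes>\<^bsub>R\<^esub> h)"
proof (rule carrier_eqI)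
  fix m x assume mx: "m \<in> M" "x \<in> V"
  let ?t = "\<lambda>u v w. koszul_sign d (u @ v @ w) * f u x * g v x * h w x"
  have "(f \<otimes>\<^bsub>R\<^esub> g \<otimes>\<^bsub>R\<^esub> h) m x = (\<Sum>(p, w)\<in>factorizations B d m. \<Sum>(u, v)\<in>factorizations B d p. ?t u v w)"
    unfolding mult_apply[OF mx]
  proof (intro sum.cong refl, clarify)
    fix p w assume pw: "(p, w) \<in> factorizations B d m"
    have "koszul_sign d (p @ w) * (f \<otimes>\<^bsub>R\<^esub> g) p x * h w x
        = (\<Sum>(u, v)\<in>factorizations B d p. koszul_sign d (p @ w) * (koszul_sign d (u @ v) * f u x * g v x) * h w x)"
      by (simp add: mult_apply factorizationsD(1)[OF pw] mx sum_distrib_left sum_distrib_right case_prod_unfold)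
    also have "\<dots> = (\<Sum>(u, v)\<in>factorizations B d p. ?t u v w)"
    proof (intro sum.cong refl, clarify)
      fix u v assume "(u, v) \<in> factorizations B d p"
      then have "p = sort (u @ v)" by (simp add: factorizations_def)
      then show "koszul_sign d (p @ w) * (koszul_sign d (u @ v) * f u x * g v x) * h w x = ?t u v w"
        using koszul_sign_sort_append(1)[of d u v w] by (simp add: algebra_simps)
    qed
    finally show "koszul_sign d (p @ w) * (f \<otimes>\<^bsub>R\<^esub> g) p x * h w x = (\<Sum>(u, v)\<in>factorizations B d p. ?t u v w)" .
  qed
  also have "\<dots> = (\<Sum>(u, p)\<in>factorizations B d m. \<Sum>(v, w)\<in>factorizations B d p. ?t u v w)"
    using factorizations_of_factors[OF mx(1), of ?t] by (simp only:)
  also have "\<dots> = (f \<otimes>\<^bsub>R\<^esub> (g \<otimes>\<^bsub>R\<^esub> h)) m x"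
    unfolding mult_apply[OF mx]
  proof (intro sum.cong refl, clarify)
    fix u p assume up: "(u, p) \<in> factorizations B d m"
    have "koszul_sign d (u @ p) * f u x * (g \<otimes>\<^bsub>R\<^esub> h) p x
        = (\<Sum>(v, w)\<in>factorizations B d p. koszul_sign d (u @ p) * f u x * (koszul_sign d (v @ w) * g v x * h w x))"
      by (simp add: mult_apply factorizationsD(2)[OF up] mx sum_distrib_left case_prod_unfold)
    also have "\<dots> = (\<Sum>(v, w)\<in>factorizations B d p. ?t u v w)"
    proof (intro sum.cong refl, clarify)
      fix v w assume "(v, w) \<in> factorizations B d p"
      then have "p = sort (v @ w)" by (simp add: factorizations_def)
      then show "koszul_sign d (u @ p) * f u x * (koszul_sign d (v @ w) * g v x * h w x) = ?t u v w"
        using koszul_sign_sort_append(2)[of d v w u] by (simp add: algebra_simps)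
    qed
    finally show "(\<Sum>(v, w)\<in>factorizations B d p. ?t u v w) = koszul_sign d (u @ p) * f u x * (g \<otimes>\<^bsub>R\<^esub> h) p x" ..
  qed
  finally show "(f \<otimes>\<^bsub>R\<^esub> g \<otimes>\<^bsub>R\<^esub> h) m x = (f \<otimes>\<^bsub>R\<^esub> (g \<otimes>\<^bsub>R\<^esub> h)) m x" .
qed (auto intro!: mult_closed assms)

text \<open>
  Only monomials of degrees \<open>i\<close> and \<open>j\<close> contribute, so the same sign comes out of every summand.
\<close>

lemma mult_swap:
  assumes "f \<in> component R i" "g \<in> component R j" "m \<in> M" "x \<in> V"
  shows "(f \<otimes>\<^bsub>R\<^esub> g) m x = (if even (i * j) then 1 else -1) * (g \<otimes>\<^bsub>R\<^esub> f) m x"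
proof -
  have "(f \<otimes>\<^bsub>R\<^esub> g) m x = (\<Sum>(v, u)\<in>factorizations B d m. koszul_sign d (u @ v) * f u x * g v x)"
    unfolding mult_apply[OF assms(3,4)]
    by (rule sum.reindex_bij_witness[of _ prod.swap prod.swap])
      (auto simp: factorizations_def intro!: properties_for_sort)
  also have "\<dots> = (\<Sum>(v, u)\<in>factorizations B d m. (if even (i * j) then 1 else -1) * (koszul_sign d (v @ u) * g v x * f u x))"
  proof (intro sum.cong refl, clarify)
    fix v u assume vu: "(v, u) \<in> factorizations B d m"
    show "koszul_sign d (u @ v) * f u x * g v x = (if even (i * j) then 1 else -1) * (koszul_sign d (v @ u) * g v x * f u x)"
    proof (cases "f u x = 0 \<or> g v x = 0")
      case False
      note D = factorizationsD[OF vu]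
      have "word_degree d u = i" "word_degree d v = j"
        using False assms D by (auto simp: component_iff)
      moreover have "sort (u @ v) = sort (v @ u)" by (intro properties_for_sort) auto
      then have "sort (u @ v) \<in> M" using vu assms(3) by (simp add: factorizations_def)
      ultimately show ?thesis
        using koszul_sign_swap[of u v B d] monomials_sorted[OF D(1)] monomials_sorted[OF D(2)] by auto
    qed auto
  qed
  also have "\<dots> = (if even (i * j) then 1 else -1) * (g \<otimes>\<^bsub>R\<^esub> f) m x"
    unfolding mult_apply[OF assms(3,4)] by (simp add: sum_distrib_left case_prod_unfold)
  finally show ?thesis .
qed

lemma one_mult:
  assumes "f \<in> carrier R"
  shows "\<one>\<^bsub>R\<^esub> \<otimes>\<^bsub>R\<^esub> f = f" "f \<otimes>\<^bsub>R\<^esub> \<one>\<^bsub>R\<^esub> = f"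
proof -
  have one: "\<one>\<^bsub>R\<^esub> \<in> carrier R" using one_component component_subset_carrier by blast
  have unit: "(\<one>\<^bsub>R\<^esub> \<otimes>\<^bsub>R\<^esub> f) m x = f m x" "(f \<otimes>\<^bsub>R\<^esub> \<one>\<^bsub>R\<^esub>) m x = f m x" if mx: "m \<in> M" "x \<in> V" for m x
  proof -
    have m: "([], m) \<in> factorizations B d m" "(m, []) \<in> factorizations B d m"
      using mx monomials_sorted[OF mx(1)] by (auto simp: factorizations_def sorted_sort_id)
    have sgn: "koszul_sign d m = 1" using mx by (simp add: koszul_sign_sorted monomials_sorted)
    have left: "u \<noteq> []" if "(u, v) \<in> factorizations B d m - {([], m)}" for u v
      using that by (auto simp: factorizations_def monomials_sorted sorted_sort_id)
    have right: "v \<noteq> []" if "(u, v) \<in> factorizations B d m - {(m, [])}" for u v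
      using that by (auto simp: factorizations_def monomials_sorted sorted_sort_id)
    have "(\<one>\<^bsub>R\<^esub> \<otimes>\<^bsub>R\<^esub> f) m x = (\<Sum>(u, v)\<in>{([], m)}. koszul_sign d (u @ v) * \<one>\<^bsub>R\<^esub> u x * f v x)"
      unfolding mult_apply[OF mx]
    proof (rule sum.mono_neutral_right)
      show "\<forall>p\<in>factorizations B d m - {([], m)}. (case p of (u, v) \<Rightarrow> koszul_sign d (u @ v) * \<one>\<^bsub>R\<^esub> u x * f v x) = 0"
      proof
        fix p assume p: "p \<in> factorizations B d m - {([], m)}"
        obtain u v where uv: "p = (u, v)" by (cases p)
        have "u \<noteq> []" using left[of u v] p uv by simp
        moreover have "u \<in> M" using factorizationsD(1)[of u v m] p uv by simp
        ultimately show "(case p of (u, v) \<Rightarrow> koszul_sign d (u @ v) * \<one>\<^bsub>R\<^esub> u x * f v x) = 0"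
          using mx(2) by (simp add: uv one_apply)
      qed
    qed (simp_all add: m)
    then show "(\<one>\<^bsub>R\<^esub> \<otimes>\<^bsub>R\<^esub> f) m x = f m x" using mx sgn by (simp add: one_apply)
    have "(f \<otimes>\<^bsub>R\<^esub> \<one>\<^bsub>R\<^esub>) m x = (\<Sum>(u, v)\<in>{(m, [])}. koszul_sign d (u @ v) * f u x * \<one>\<^bsub>R\<^esub> v x)"
      unfolding mult_apply[OF mx]
    proof (rule sum.mono_neutral_right)
      show "\<forall>p\<in>factorizations B d m - {(m, [])}. (case p of (u, v) \<Rightarrow> koszul_sign d (u @ v) * f u x * \<one>\<^bsub>R\<^esub> v x) = 0"
      proof
        fix p assume p: "p \<in> factorizations B d m - {(m, [])}"
        obtain u v where uv: "p = (u, v)" by (cases p)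
        have "v \<noteq> []" using right[of u v] p uv by simp
        moreover have "v \<in> M" using factorizationsD(2)[of u v m] p uv by simp
        ultimately show "(case p of (u, v) \<Rightarrow> koszul_sign d (u @ v) * f u x * \<one>\<^bsub>R\<^esub> v x) = 0"
          using mx(2) by (simp add: uv one_apply)
      qed
    qed (simp_all add: m)
    then show "(f \<otimes>\<^bsub>R\<^esub> \<one>\<^bsub>R\<^esub>) m x = f m x" using mx sgn by (simp add: one_apply)
  qed
  show "\<one>\<^bsub>R\<^esub> \<otimes>\<^bsub>R\<^esub> f = f" "f \<otimes>\<^bsub>R\<^esub> \<one>\<^bsub>R\<^esub> = f"
    by (rule carrier_eqI; simp add: unit mult_closed one assms)+
qed

lemma ring_domain_ring: "ring R"
proof (rule ringI)
  show "abelian_group R"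
  proof (rule abelian_groupI)
    fix f assume f: "f \<in> carrier R"
    let ?g = "\<lambda>m\<in>M. \<lambda>x\<in>V. -1 * f m x"
    have "?g \<in> carrier R" by (rule scale_closed[OF f])
    moreover have "?g \<oplus>\<^bsub>R\<^esub> f = \<zero>\<^bsub>R\<^esub>"
      by (rule carrier_eqI) (use scale_closed[OF f, of "\<lambda>_. -1"] f in \<open>auto simp: add_closed zero_closed add_apply zero_apply\<close>)
    ultimately show "\<exists>g\<in>carrier R. g \<oplus>\<^bsub>R\<^esub> f = \<zero>\<^bsub>R\<^esub>" by blast
  qed (auto intro!: carrier_eqI add_closed zero_closed simp: add_apply zero_apply)
  show "monoid R"
    by (rule monoidI) (use one_component component_subset_carrier in \<open>auto intro: mult_closed mult_assoc one_mult\<close>)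
next
  fix f g h assume fgh: "f \<in> carrier R" "g \<in> carrier R" "h \<in> carrier R"
  show "(f \<oplus>\<^bsub>R\<^esub> g) \<otimes>\<^bsub>R\<^esub> h = f \<otimes>\<^bsub>R\<^esub> h \<oplus>\<^bsub>R\<^esub> g \<otimes>\<^bsub>R\<^esub> h"
  proof (rule carrier_eqI)
    fix m x assume mx: "m \<in> M" "x \<in> V"
    show "((f \<oplus>\<^bsub>R\<^esub> g) \<otimes>\<^bsub>R\<^esub> h) m x = (f \<otimes>\<^bsub>R\<^esub> h \<oplus>\<^bsub>R\<^esub> g \<otimes>\<^bsub>R\<^esub> h) m x"
      unfolding add_apply[OF mx] mult_apply[OF mx] sum.distrib[symmetric]
      by (intro sum.cong refl, clarify)
        (simp add: add_apply[OF _ mx(2)] factorizationsD(1) algebra_simps)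
  qed (use fgh in \<open>simp_all add: add_closed mult_closed\<close>)
  show "h \<otimes>\<^bsub>R\<^esub> (f \<oplus>\<^bsub>R\<^esub> g) = h \<otimes>\<^bsub>R\<^esub> f \<oplus>\<^bsub>R\<^esub> h \<otimes>\<^bsub>R\<^esub> g"
  proof (rule carrier_eqI)
    fix m x assume mx: "m \<in> M" "x \<in> V"
    show "(h \<otimes>\<^bsub>R\<^esub> (f \<oplus>\<^bsub>R\<^esub> g)) m x = (h \<otimes>\<^bsub>R\<^esub> f \<oplus>\<^bsub>R\<^esub> h \<otimes>\<^bsub>R\<^esub> g) m x"
      unfolding add_apply[OF mx] mult_apply[OF mx] sum.distrib[symmetric]
      by (intro sum.cong refl, clarify)
        (simp add: add_apply[OF _ mx(2)] factorizationsD(2) algebra_simps)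
  qed (use fgh in \<open>simp_all add: add_closed mult_closed\<close>)
qed

lemma
  shows a_inv_apply: "\<lbrakk>f \<in> carrier R; m \<in> M; x \<in> V\<rbrakk> \<Longrightarrow> (\<ominus>\<^bsub>R\<^esub> f) m x = - f m x"
    and finsum_apply: "\<lbrakk>finite A; c \<in> A \<rightarrow> carrier R; m \<in> M; x \<in> V\<rbrakk> \<Longrightarrow> finsum R c A m x = (\<Sum>k\<in>A. c k m x)"
proof -
  interpret ring R by (rule ring_domain_ring)
  show "(\<ominus>\<^bsub>R\<^esub> f) m x = - f m x" if "f \<in> carrier R" "m \<in> M" "x \<in> V" for f m x
  proof -
    have "(f \<oplus>\<^bsub>R\<^esub> \<ominus>\<^bsub>R\<^esub> f) m x = 0" using that by (simp only: r_neg zero_apply)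
    then show ?thesis using that by (simp add: add_apply)
  qed
  show "finsum R c A m x = (\<Sum>k\<in>A. c k m x)"
    if "finite A" "c \<in> A \<rightarrow> carrier R" "m \<in> M" "x \<in> V" for A and c :: "'i \<Rightarrow> 'b series" and m x
    using that(1,2)
  proof (induction A)
    case (insert k A)
    then have "c \<in> A \<rightarrow> carrier R" "c k \<in> carrier R" by auto
    then show ?case using insert that(3,4) by (simp add: finsum_insert add_apply)
  qed (simp add: zero_apply that)
qed

lemma component_subgroup: "additive_subgroup (component R k) R"
proof -
  interpret ring R by (rule ring_domain_ring)
  show ?thesis
  proof (rule additive_subgroup_intro)
    show "\<zero>\<^bsub>R\<^esub> \<in> component R k"
      using zero_closed by (simp add: component_iff carrier_iff zero_apply)
    show "f \<oplus>\<^bsub>R\<^esub> g \<in> component R k" if "f \<in> component R k" "g \<in> component R k" for f g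
      unfolding component_iff
    proof (intro conjI ballI impI)
      fix m x assume mx: "m \<in> M" "x \<in> V" "(f \<oplus>\<^bsub>R\<^esub> g) m x \<noteq> 0"
      then have "f m x \<noteq> 0 \<or> g m x \<noteq> 0" by (auto simp: add_apply)
      then show "word_degree d m = k" using that mx(1,2) unfolding component_iff by blast
    qed (use that in \<open>simp add: component_iff add_series\<close>)
    show "\<ominus>\<^bsub>R\<^esub> f \<in> component R k" if f: "f \<in> component R k" for f
    proof -
      have "f \<in> carrier R" using f component_subset_carrier by blast
      then have "\<ominus>\<^bsub>R\<^esub> f \<in> carrier R" "\<And>m x. m \<in> M \<Longrightarrow> x \<in> V \<Longrightarrow> (\<ominus>\<^bsub>R\<^esub> f) m x = - f m x"
        by (simp_all add: a_inv_apply)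
      then show ?thesis using f by (simp add: component_iff carrier_iff)
    qed
  qed (rule component_subset_carrier)
qed

text \<open>
  The coefficient of \<open>m\<close> in a sum of homogeneous series comes from the summand of degree
  \<^term>\<open>word_degree d m\<close> alone. This recovers the summands from the sum.
\<close>

lemma family_sum_apply:
  assumes c: "graded_family R (component R) c" and mx: "m \<in> M" "x \<in> V"
  shows "family_sum R c m x = c (word_degree d m) m x"
proof -
  have ck: "c k \<in> component R k" "c k \<in> carrier R" for k
    using c component_subset_carrier by (auto simp: graded_family_def)
  have "family_sum R c m x = (\<Sum>k\<in>{k. c k \<noteq> \<zero>\<^bsub>R\<^esub>}. c k m x)"
    unfolding family_sum_def
    by (rule finsum_apply) (use c mx ck in \<open>auto simp: graded_family_def\<close>)
  also have "\<dots> = (\<Sum>k\<in>{k. c k \<noteq> \<zero>\<^bsub>R\<^esub>}. if k = word_degree d m then c (word_degree d m) m x else 0)"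
    using ck(1) mx unfolding component_iff by (intro sum.cong) auto
  also have "\<dots> = c (word_degree d m) m x"
    using c mx by (auto simp: graded_family_def zero_apply)
  finally show ?thesis .
qed

lemma direct_sum: "internal_direct_sum R (component R) (carrier R)"
  unfolding internal_direct_sum_def
proof (intro conjI allI)
  interpret ring R by (rule ring_domain_ring)
  have closed: "family_sum R c \<in> carrier R" if "graded_family R (component R) c" for c
    unfolding family_sum_def using that component_subset_carrier
    by (intro finsum_closed) (auto simp: graded_family_def)
  show "carrier R = family_sum R ` {c. graded_family R (component R) c}"
  proof (intro equalityI subsetI)
    fix f assume f: "f \<in> carrier R"
    \<comment> \<open>The homogeneous part of degree \<open>k\<close>.\<close>
    define c where "c k = (\<lambda>m\<in>M. \<lambda>x\<in>V. (if word_degree d m = k then 1 else 0) * f m x)" for k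
    have "c k \<in> formal_series n B d V" for k
      unfolding c_def using f by (intro scale_series) (simp add: carrier_iff)
    then have ck: "c k \<in> component R k" for k
      by (auto simp: component_iff c_def)
    moreover have "{k. c k \<noteq> \<zero>\<^bsub>R\<^esub>} \<subseteq> series_degrees B d V f"
    proof (rule ccontr)
      assume "\<not> ?thesis"
      then obtain k where k: "c k \<noteq> \<zero>\<^bsub>R\<^esub>" "k \<notin> series_degrees B d V f" by blast
      have "c k = \<zero>\<^bsub>R\<^esub>"
      proof (rule carrier_eqI)
        show "c k m x = \<zero>\<^bsub>R\<^esub> m x" if "m \<in> M" "x \<in> V" for m x
          using series_degreesI[OF that, of f] k(2) that by (auto simp: c_def zero_apply)
      qed (use ck component_subset_carrier zero_closed in auto)
      with k show False by simp
    qed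
    ultimately have fam: "graded_family R (component R) c"
      using f unfolding graded_family_def carrier_iff by (meson finite_subset)
    have "family_sum R c = f"
      by (rule carrier_eqI) (use fam f closed in \<open>auto simp: family_sum_apply c_def\<close>)
    then show "f \<in> family_sum R ` {c. graded_family R (component R) c}" using fam by blast
  qed (use closed in auto)
  show "inj_on (family_sum R) {c. graded_family R (component R) c}"
  proof (rule inj_onI, clarify)
    fix c e assume c: "graded_family R (component R) c" and e: "graded_family R (component R) e"
      and eq: "family_sum R c = family_sum R e"
    show "c = e"
    proof
      fix k
      have ck: "c k \<in> component R k" and ek: "e k \<in> component R k" using c e by (auto simp: graded_family_def)
      show "c k = e k"
      proof (rule carrier_eqI)
        fix m x assume mx: "m \<in> M" "x \<in> V"
        show "c k m x = e k m x"
        proof (cases "word_degree d m = k")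
          case True
          then show ?thesis using family_sum_apply[OF c mx] family_sum_apply[OF e mx] eq by simp
        next
          case False
          then have "c k m x = 0" "e k m x = 0" using ck ek mx unfolding component_iff by blast+
          then show ?thesis by simp
        qed
      qed (use ck ek component_subset_carrier in auto)
    qed
  qed
qed (rule component_subgroup)

theorem supercommutative_domain_ring: "supercommutative_graded_ring R"
proof -
  interpret ring R by (rule ring_domain_ring)
  show ?thesis
  proof
    show "f \<otimes>\<^bsub>R\<^esub> g = (if even (i * j) then g \<otimes>\<^bsub>R\<^esub> f else \<ominus>\<^bsub>R\<^esub> (g \<otimes>\<^bsub>R\<^esub> f))"
      if fg: "f \<in> component R i" "g \<in> component R j" for f g i j
    proof (rule carrier_eqI)
      have car: "f \<in> carrier R" "g \<in> carrier R" using fg component_subset_carrier by auto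
      then show "f \<otimes>\<^bsub>R\<^esub> g \<in> carrier R" "(if even (i * j) then g \<otimes>\<^bsub>R\<^esub> f else \<ominus>\<^bsub>R\<^esub> (g \<otimes>\<^bsub>R\<^esub> f)) \<in> carrier R"
        by simp_all
      show "(f \<otimes>\<^bsub>R\<^esub> g) m x = (if even (i * j) then g \<otimes>\<^bsub>R\<^esub> f else \<ominus>\<^bsub>R\<^esub> (g \<otimes>\<^bsub>R\<^esub> f)) m x"
        if "m \<in> M" "x \<in> V" for m x
        using mult_swap[OF fg that] car that by (auto simp: a_inv_apply)
    qed
  qed (use direct_sum component_mult in auto)
qed

end

section \<open>The structure sheaf\<close>

lemma domain_sheaf_simps:
  "Sections (domain_sheaf n B d) = domain_ring n B d"
  "restriction (domain_sheaf n B d) V W f = (\<lambda>m\<in>monomials B d. restrict (f m) W)"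
  by (simp_all add: domain_sheaf_def)

lemma openin_subset_Euclidean_space:
  assumes "openin (Euclidean_space n) U" "openin (subtopology (Euclidean_space n) U) V"
  shows "openin (Euclidean_space n) V" "V \<subseteq> U"
  using assms openin_open_subtopology by blast+

locale domain_restriction = V: domain_sections n B d V + W: domain_sections n B d W
  for n :: nat and B :: "'b::linorder set" and d V W +
  assumes subset: "W \<subseteq> V"
begin

abbreviation "\<rho> \<equiv> restriction (domain_sheaf n B d) V W"

lemma restriction_apply: "m \<in> V.M \<Longrightarrow> x \<in> W \<Longrightarrow> \<rho> f m x = f m x"
  by (simp add: domain_sheaf_simps)

lemma restriction_series:
  assumes "f \<in> formal_series n B d V"
  shows "\<rho> f \<in> formal_series n B d W"
proof -
  have "smooth_on n W (f m)" if "m \<in> V.M" for m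
    using V.formal_series_smooth[OF assms that] subset by (rule smooth_on_subset[OF V.open_V W.open_V, rotated])
  from W.formal_seriesI[OF this] show ?thesis by (simp add: domain_sheaf_simps restrict_def)
qed

lemma restriction_carrier:
  assumes "f \<in> carrier V.R"
  shows "\<rho> f \<in> carrier W.R"
proof (rule W.carrierI)
  show "\<rho> f \<in> formal_series n B d W" "finite (series_degrees B d V f)"
    using assms restriction_series by (simp_all add: V.carrier_iff)
  show "word_degree d m \<in> series_degrees B d V f" if "m \<in> V.M" "x \<in> W" "\<rho> f m x \<noteq> 0" for m x
    using that subset by (intro V.series_degreesI[of m x]) (auto simp: restriction_apply)
qed

lemma restriction_component:
  assumes "f \<in> component V.R k"
  shows "\<rho> f \<in> component W.R k"
  using assms restriction_series[of f] subset unfolding V.component_iff W.component_iff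
  by (auto simp: restriction_apply subset_iff)

lemma restriction_hom: "\<rho> \<in> ring_hom V.R W.R"
proof (rule ring_hom_memI)
  interpret VR: ring V.R by (rule V.ring_domain_ring)
  interpret WR: ring W.R by (rule W.ring_domain_ring)
  have sub: "x \<in> V" if "x \<in> W" for x using that subset by blast
  fix f g assume fg: "f \<in> carrier V.R" "g \<in> carrier V.R"
  show "\<rho> (f \<otimes>\<^bsub>V.R\<^esub> g) = \<rho> f \<otimes>\<^bsub>W.R\<^esub> \<rho> g"
  proof (rule W.carrier_eqI)
    fix m x assume mx: "m \<in> V.M" "x \<in> W"
    show "\<rho> (f \<otimes>\<^bsub>V.R\<^esub> g) m x = (\<rho> f \<otimes>\<^bsub>W.R\<^esub> \<rho> g) m x"
      unfolding restriction_apply[OF mx] V.mult_apply[OF mx(1) sub[OF mx(2)]] W.mult_apply[OF mx]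
    proof (intro sum.cong refl, clarify)
      fix u v assume "(u, v) \<in> factorizations B d m"
      then show "koszul_sign d (u @ v) * f u x * g v x = koszul_sign d (u @ v) * \<rho> f u x * \<rho> g v x"
        using V.factorizationsD(1,2)[of u v m] mx(2) by (simp add: restriction_apply)
    qed
  qed (use fg restriction_carrier in simp_all)
  show "\<rho> (f \<oplus>\<^bsub>V.R\<^esub> g) = \<rho> f \<oplus>\<^bsub>W.R\<^esub> \<rho> g"
    by (rule W.carrier_eqI)
      (use fg restriction_carrier sub in \<open>simp_all add: restriction_apply V.add_apply W.add_apply\<close>)
next
  interpret VR: ring V.R by (rule V.ring_domain_ring)
  interpret WR: ring W.R by (rule W.ring_domain_ring)
  have sub: "x \<in> V" if "x \<in> W" for x using that subset by blast
  show "\<rho> \<one>\<^bsub>V.R\<^esub> = \<one>\<^bsub>W.R\<^esub>"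
    by (rule W.carrier_eqI)
      (use restriction_carrier sub in \<open>simp_all add: restriction_apply V.one_apply W.one_apply\<close>)
qed (rule restriction_carrier)

end

text \<open>
  Smoothness of the glued coefficients is a local property. The finiteness of the set of degrees is not
  local; it is ensured by the common degree \<open>k\<close> of the pieces.
\<close>

lemma glue_components:
  fixes B :: "'b::linorder set"
  assumes opens: "\<And>V. V \<in> \<V> \<Longrightarrow> openin (Euclidean_space n) V"
    and \<sigma>: "\<And>V. V \<in> \<V> \<Longrightarrow> \<sigma> V \<in> component (domain_ring n B d V) k"
    and compat: "\<And>V W m x. \<lbrakk>V \<in> \<V>; W \<in> \<V>; m \<in> monomials B d; x \<in> V \<inter> W\<rbrakk> \<Longrightarrow> \<sigma> V m x = \<sigma> W m x"
  shows "\<exists>s\<in>component (domain_ring n B d (\<Union>\<V>)) k. \<forall>V\<in>\<V>. \<forall>m\<in>monomials B d. \<forall>x\<in>V. s m x = \<sigma> V m x"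
proof -
  interpret U: domain_sections n B d "\<Union>\<V>"
    by standard (rule openin_Union, rule opens)
  \<comment> \<open>Compatibility makes the values independent of the chosen member of the cover.\<close>
  define h where "h m x = \<sigma> (SOME V. V \<in> \<V> \<and> x \<in> V) m x" for m x
  have h: "h m x = \<sigma> V m x" if "V \<in> \<V>" "m \<in> U.M" "x \<in> V" for V m x
  proof -
    have "(SOME V. V \<in> \<V> \<and> x \<in> V) \<in> \<V> \<and> x \<in> (SOME V. V \<in> \<V> \<and> x \<in> V)"
      by (rule someI[of "\<lambda>V. V \<in> \<V> \<and> x \<in> V" V]) (use that in simp)
    then show ?thesis unfolding h_def using that by (intro compat) auto
  qed
  let ?s = "\<lambda>m\<in>U.M. \<lambda>x\<in>\<Union>\<V>. h m x"
  have "smooth_on n (\<Union>\<V>) (h m)" if m: "m \<in> U.M" for m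
  proof (rule smooth_on_local[OF U.open_V])
    fix x assume "x \<in> \<Union>\<V>"
    then obtain V where V: "V \<in> \<V>" "x \<in> V" by blast
    interpret V: domain_sections n B d V by standard (rule opens[OF V(1)])
    have "smooth_on n V (\<sigma> V m)"
      using \<sigma>[OF V(1)] m V.formal_series_smooth unfolding V.component_iff by blast
    then have "smooth_on n V (h m)"
      using smooth_on_cong[OF V.open_V, of "h m" "\<sigma> V m"] h[OF V(1) m] by simp
    then show "\<exists>V. openin (Euclidean_space n) V \<and> x \<in> V \<and> V \<subseteq> \<Union>\<V> \<and> smooth_on n V (h m)"
      using V V.open_V by (intro exI[of _ V] conjI) auto
  qed
  then have "?s \<in> formal_series n B d (\<Union>\<V>)" by (rule U.formal_seriesI)
  moreover have "word_degree d m = k" if mx: "m \<in> U.M" "x \<in> \<Union>\<V>" "?s m x \<noteq> 0" for m x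
  proof -
    obtain V where V: "V \<in> \<V>" "x \<in> V" using mx(2) by blast
    interpret V: domain_sections n B d V by standard (rule opens[OF V(1)])
    have "\<sigma> V m x \<noteq> 0" using mx h[OF V(1) mx(1) V(2)] by simp
    then show ?thesis using \<sigma>[OF V(1)] mx(1) V(2) unfolding V.component_iff by blast
  qed
  ultimately have "?s \<in> component U.R k" unfolding U.component_iff by blast
  moreover have "\<forall>V\<in>\<V>. \<forall>m\<in>U.M. \<forall>x\<in>V. ?s m x = \<sigma> V m x" using h by auto
  ultimately show ?thesis by blast
qed

theorem domain_sheaf_graded_ringed_space:
  fixes B :: "'b::linorder set"
  assumes U: "openin (Euclidean_space n) U"
  shows "graded_ringed_space (subtopology (Euclidean_space n) U) (domain_sheaf n B d)"
proof -
  let ?X = "subtopology (Euclidean_space n) U" and ?O = "domain_sheaf n B d"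
  have sections: "domain_sections n V" if "openin ?X V" for V
    using openin_subset_Euclidean_space(1)[OF U that] by (rule domain_sections.intro)
  have restr: "domain_restriction n V W" if "openin ?X V" "openin ?X W" "W \<subseteq> V" for V W
    using sections that by (simp add: domain_restriction_def domain_restriction_axioms_def)
  show ?thesis
  proof (intro graded_ringed_space.intro graded_presheaf.intro graded_ringed_space_axioms.intro)
    show "supercommutative_graded_ring (Sections ?O V)" if "openin ?X V" for V
      unfolding domain_sheaf_simps by (rule domain_sections.supercommutative_domain_ring[OF sections[OF that]])
    show "restriction ?O V W \<in> ring_hom (Sections ?O V) (Sections ?O W)"
      if "openin ?X V" "openin ?X W" "W \<subseteq> V" for V W
      unfolding domain_sheaf_simps(1) by (rule domain_restriction.restriction_hom[OF restr[OF that]])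
    show "restriction ?O V W s \<in> component (Sections ?O W) k"
      if "openin ?X V" "openin ?X W" "W \<subseteq> V" "s \<in> component (Sections ?O V) k" for V W s k
      using that(4) unfolding domain_sheaf_simps(1)
      by (rule domain_restriction.restriction_component[OF restr[OF that(1-3)]])
    show "restriction ?O V V s = s" if V: "openin ?X V" and s: "s \<in> carrier (Sections ?O V)" for V s
    proof -
      interpret V: domain_restriction n B d V V by (rule restr) (use V in auto)
      show ?thesis
        by (rule V.V.carrier_eqI) (use s V.restriction_carrier in \<open>simp_all add: domain_sheaf_simps(1) V.restriction_apply\<close>)
    qed
    show "restriction ?O W Z (restriction ?O V W s) = restriction ?O V Z s"
      if "openin ?X V" "openin ?X W" "openin ?X Z" "Z \<subseteq> W" "W \<subseteq> V" "s \<in> carrier (Sections ?O V)" for V W Z s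
      using that(4) by (auto simp: domain_sheaf_simps fun_eq_iff)
    show "s = t"
      if opens: "\<And>V. V \<in> \<V> \<Longrightarrow> openin ?X V"
        and st: "s \<in> carrier (Sections ?O (\<Union>\<V>))" "t \<in> carrier (Sections ?O (\<Union>\<V>))"
        and eq: "\<And>V. V \<in> \<V> \<Longrightarrow> restriction ?O (\<Union>\<V>) V s = restriction ?O (\<Union>\<V>) V t" for \<V> s t
    proof -
      interpret U: domain_sections n B d "\<Union>\<V>" by (intro sections openin_Union opens)
      show ?thesis
      proof (rule U.carrier_eqI)
        fix m x assume m: "m \<in> U.M" and "x \<in> \<Union>\<V>"
        then obtain V where V: "V \<in> \<V>" "x \<in> V" by blast
        interpret V: domain_restriction n B d "\<Union>\<V>" V
          by (intro restr openin_Union) (use opens V in auto)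
        show "s m x = t m x"
          using V.restriction_apply[OF m V(2), of s] V.restriction_apply[OF m V(2), of t] eq[OF V(1)] by simp
      qed (use st in \<open>simp_all add: domain_sheaf_simps\<close>)
    qed
    show "\<exists>s\<in>component (Sections ?O (\<Union>\<V>)) k. \<forall>V\<in>\<V>. restriction ?O (\<Union>\<V>) V s = \<sigma> V"
      if opens: "\<And>V. V \<in> \<V> \<Longrightarrow> openin ?X V"
        and \<sigma>: "\<And>V. V \<in> \<V> \<Longrightarrow> \<sigma> V \<in> component (Sections ?O V) k"
        and compat: "\<And>V W. \<lbrakk>V \<in> \<V>; W \<in> \<V>\<rbrakk> \<Longrightarrow>
          restriction ?O V (V \<inter> W) (\<sigma> V) = restriction ?O W (V \<inter> W) (\<sigma> W)" for \<V> \<sigma> k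
    proof -
      have "\<exists>s\<in>component (domain_ring n B d (\<Union>\<V>)) k. \<forall>V\<in>\<V>. \<forall>m\<in>monomials B d. \<forall>x\<in>V. s m x = \<sigma> V m x"
      proof (rule glue_components)
        show "openin (Euclidean_space n) V" if "V \<in> \<V>" for V
          using openin_subset_Euclidean_space(1)[OF U opens[OF that]] .
        show "\<sigma> V \<in> component (domain_ring n B d V) k" if "V \<in> \<V>" for V
          using \<sigma>[OF that] by (simp add: domain_sheaf_simps)
        show "\<sigma> V m x = \<sigma> W m x" if VW: "V \<in> \<V>" "W \<in> \<V>" and mx: "m \<in> monomials B d" "x \<in> V \<inter> W" for V W m x
          using fun_cong[OF fun_cong[OF compat[OF VW], of m], of x] mx by (simp add: domain_sheaf_simps)
      qed
      then obtain s where s: "s \<in> component (domain_ring n B d (\<Union>\<V>)) k"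
        and eq: "\<And>V m x. \<lbrakk>V \<in> \<V>; m \<in> monomials B d; x \<in> V\<rbrakk> \<Longrightarrow> s m x = \<sigma> V m x" by blast
      have "restriction ?O (\<Union>\<V>) V s = \<sigma> V" if V: "V \<in> \<V>" for V
      proof -
        interpret V: domain_restriction n B d "\<Union>\<V>" V
          by (intro restr openin_Union) (use opens V in auto)
        show ?thesis
        proof (rule V.W.carrier_eqI)
          show "restriction ?O (\<Union>\<V>) V s \<in> carrier V.W.R"
            using V.restriction_component[OF s] V.W.component_subset_carrier by blast
          show "\<sigma> V \<in> carrier V.W.R"
            using \<sigma>[OF V] V.W.component_subset_carrier by (auto simp: domain_sheaf_simps)
        qed (use eq[OF V] V.restriction_apply in simp)
      qed
      then show ?thesis using s unfolding domain_sheaf_simps(1) by blast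
    qed
  qed
qed

section \<open>Stalks are graded rings\<close>

context graded_presheaf
begin

abbreviation S where "S \<equiv> Sections \<O>"
abbreviation \<rho> where "\<rho> \<equiv> restriction \<O>"

lemma graded_ring_sections: "openin X V \<Longrightarrow> graded_ring (S V)"
  using sections_ring by (simp add: supercommutative_graded_ring_def)

lemma ring_sections: "openin X V \<Longrightarrow> ring (S V)"
  using graded_ring_sections graded_ring.axioms(1) by blast

lemma component_sections_carrier: "openin X V \<Longrightarrow> s \<in> component (S V) k \<Longrightarrow> s \<in> carrier (S V)"
  using graded_ring.component_carrier[OF graded_ring_sections] by blast

lemma graded_family_sections:
  assumes "openin X V" "graded_family (S V) (component (S V)) c"
  shows "c k \<in> component (S V) k" "c k \<in> carrier (S V)"
proof -
  show "c k \<in> component (S V) k" using assms(2) by (simp add: graded_family_def)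
  then show "c k \<in> carrier (S V)" by (rule component_sections_carrier[OF assms(1)])
qed

lemma restriction_ring_hom: "\<lbrakk>openin X V; openin X W; W \<subseteq> V\<rbrakk> \<Longrightarrow> ring_hom_ring (S V) (S W) (\<rho> V W)"
  by (intro ring_hom_ringI2 ring_sections restriction_hom)

lemma restriction_closed: "\<lbrakk>openin X V; openin X W; W \<subseteq> V; s \<in> carrier (S V)\<rbrakk> \<Longrightarrow> \<rho> V W s \<in> carrier (S W)"
  using restriction_hom ring_hom_closed by metis

end

locale stalk_at = graded_presheaf X \<O>
  for X :: "'x topology" and \<O> :: "('x, 's) presheaf" +
  fixes x :: 'x
  assumes point: "x \<in> topspace X"
begin

abbreviation "nbhd V \<equiv> openin X V \<and> x \<in> V"
abbreviation "G \<equiv> germ X \<O> x"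
abbreviation "St \<equiv> stalk X \<O> x"

lemma nbhd_topspace: "nbhd (topspace X)"
  using point by simp

lemma equiv_germ_rel: "equiv (local_sections X \<O> x) (germ_rel X \<O> x)"
proof (rule equivI)
  show "germ_rel X \<O> x \<subseteq> local_sections X \<O> x \<times> local_sections X \<O> x"
    by (auto simp: germ_rel_def)
  show "refl_on (local_sections X \<O> x) (germ_rel X \<O> x)"
    by (rule refl_onI) (auto simp: germ_rel_def local_sections_def)
  show "sym (germ_rel X \<O> x)"
  proof (rule symI)
    fix a b assume ab: "(a, b) \<in> germ_rel X \<O> x"
    obtain V s where a: "a = (V, s)" by (cases a)
    obtain W t where b: "b = (W, t)" by (cases b)
    from ab obtain Z where Z: "nbhd Z" "Z \<subseteq> V \<inter> W" "\<rho> V Z s = \<rho> W Z t"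
      and loc: "(V, s) \<in> local_sections X \<O> x" "(W, t) \<in> local_sections X \<O> x"
      by (auto simp: a b germ_rel_def)
    have "\<exists>Z. openin X Z \<and> x \<in> Z \<and> Z \<subseteq> W \<inter> V \<and> \<rho> W Z t = \<rho> V Z s"
      using Z by (intro exI[of _ Z]) auto
    then show "(b, a) \<in> germ_rel X \<O> x"
      using loc by (simp add: a b germ_rel_def)
  qed
  show "trans (germ_rel X \<O> x)"
  proof (rule transI)
    fix a b c assume ab: "(a, b) \<in> germ_rel X \<O> x" and bc: "(b, c) \<in> germ_rel X \<O> x"
    obtain V s where a: "a = (V, s)" by (cases a)
    obtain W t where b: "b = (W, t)" by (cases b)
    obtain Y u where c: "c = (Y, u)" by (cases c)
    from ab obtain Z where Z: "nbhd Z" "Z \<subseteq> V \<inter> W" "\<rho> V Z s = \<rho> W Z t"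
      and loc: "nbhd V" "s \<in> carrier (S V)" "nbhd W" "t \<in> carrier (S W)"
      by (auto simp: a b germ_rel_def local_sections_def)
    from bc obtain Z' where Z': "nbhd Z'" "Z' \<subseteq> W \<inter> Y" "\<rho> W Z' t = \<rho> Y Z' u"
      and loc': "nbhd Y" "u \<in> carrier (S Y)"
      by (auto simp: b c germ_rel_def local_sections_def)
    have int: "nbhd (Z \<inter> Z')" using Z Z' by (auto intro: openin_Int)
    have "\<rho> V (Z \<inter> Z') s = \<rho> Z (Z \<inter> Z') (\<rho> V Z s)"
      by (rule restriction_comp[symmetric]) (use Z loc int in auto)
    also have "\<dots> = \<rho> W (Z \<inter> Z') t"
      unfolding Z(3) by (rule restriction_comp) (use Z loc int in auto)
    also have "\<dots> = \<rho> Z' (Z \<inter> Z') (\<rho> W Z' t)"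
      by (rule restriction_comp[symmetric]) (use Z' loc int in auto)
    also have "\<dots> = \<rho> Y (Z \<inter> Z') u"
      unfolding Z'(3) by (rule restriction_comp) (use Z' loc' int in auto)
    finally have "\<exists>Z. openin X Z \<and> x \<in> Z \<and> Z \<subseteq> V \<inter> Y \<and> \<rho> V Z s = \<rho> Y Z u"
      using int Z(2) Z'(2) by (intro exI[of _ "Z \<inter> Z'"]) auto
    then show "(a, c) \<in> germ_rel X \<O> x"
      using loc loc' by (simp add: a c germ_rel_def local_sections_def)
  qed
qed

lemma germ_eq_iff:
  assumes "nbhd V" "s \<in> carrier (S V)" "nbhd W" "t \<in> carrier (S W)"
  shows "G V s = G W t \<longleftrightarrow> (\<exists>Z. nbhd Z \<and> Z \<subseteq> V \<inter> W \<and> \<rho> V Z s = \<rho> W Z t)"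
proof -
  have "(V, s) \<in> local_sections X \<O> x" "(W, t) \<in> local_sections X \<O> x"
    using assms by (auto simp: local_sections_def)
  then have "G V s = G W t \<longleftrightarrow> ((V, s), (W, t)) \<in> germ_rel X \<O> x"
    unfolding germ_def using eq_equiv_class_iff[OF equiv_germ_rel] by blast
  also have "\<dots> \<longleftrightarrow> (\<exists>Z. nbhd Z \<and> Z \<subseteq> V \<inter> W \<and> \<rho> V Z s = \<rho> W Z t)"
    using assms by (simp add: germ_rel_def local_sections_def)
  finally show ?thesis .
qed

lemma germ_restriction:
  assumes "nbhd V" "s \<in> carrier (S V)" "nbhd W" "W \<subseteq> V"
  shows "G W (\<rho> V W s) = G V s"
proof -
  have "\<rho> W W (\<rho> V W s) = \<rho> V W s"
    by (rule restriction_id) (use assms restriction_closed in auto)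
  then show ?thesis
    using assms restriction_closed[of V W s] by (subst germ_eq_iff) auto
qed

lemma mem_germ_iff:
  assumes "nbhd V" "s \<in> carrier (S V)"
  shows "(W, t) \<in> G V s \<longleftrightarrow> nbhd W \<and> t \<in> carrier (S W) \<and> G W t = G V s"
proof -
  have V: "(V, s) \<in> local_sections X \<O> x"
    using assms by (auto simp: local_sections_def)
  have rel: "(W, t) \<in> G V s \<longleftrightarrow> ((V, s), (W, t)) \<in> germ_rel X \<O> x"
    by (simp add: germ_def)
  show ?thesis
  proof (cases "nbhd W \<and> t \<in> carrier (S W)")
    case True
    then have "(W, t) \<in> local_sections X \<O> x" by (simp add: local_sections_def)
    with V have "G V s = G W t \<longleftrightarrow> ((V, s), (W, t)) \<in> germ_rel X \<O> x"
      unfolding germ_def by (rule eq_equiv_class_iff[OF equiv_germ_rel])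
    with True rel show ?thesis by (simp only: simp_thms eq_commute[of "G W t"])
  next
    case False
    then have "(W, t) \<notin> local_sections X \<O> x" by (simp add: local_sections_def)
    then have "((V, s), (W, t)) \<notin> germ_rel X \<O> x" by (auto simp: germ_rel_def)
    with False rel show ?thesis by blast
  qed
qed

lemma stalk_carrier_iff: "a \<in> carrier St \<longleftrightarrow> (\<exists>V s. nbhd V \<and> s \<in> carrier (S V) \<and> a = G V s)"
  by (auto simp: stalk_def quotient_def germ_def local_sections_def)

lemma germ_closed: "nbhd V \<Longrightarrow> s \<in> carrier (S V) \<Longrightarrow> G V s \<in> carrier St"
  unfolding stalk_carrier_iff by blast

lemma stalk_component_iff: "a \<in> component St k \<longleftrightarrow> (\<exists>V s. nbhd V \<and> s \<in> component (S V) k \<and> a = G V s)"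
  by (auto simp: stalk_def)

text \<open>
  The operations of the stalk are unions over all representatives of both arguments. For an operation
  that commutes with restriction, all representatives yield the same germ. Addition and multiplication
  are both instances.
\<close>

lemma germ_operation:
  assumes closed: "\<And>V s t. \<lbrakk>nbhd V; s \<in> carrier (S V); t \<in> carrier (S V)\<rbrakk> \<Longrightarrow> f V s t \<in> carrier (S V)"
    and restrict: "\<And>V W s t. \<lbrakk>nbhd V; nbhd W; W \<subseteq> V; s \<in> carrier (S V); t \<in> carrier (S V)\<rbrakk> \<Longrightarrow>
      \<rho> V W (f V s t) = f W (\<rho> V W s) (\<rho> V W t)"
    and V: "nbhd V" "s \<in> carrier (S V)" "t \<in> carrier (S V)"
  shows "(\<Union>(W, u)\<in>G V s. \<Union>(Y, v)\<in>G V t. G (W \<inter> Y) (f (W \<inter> Y) (\<rho> W (W \<inter> Y) u) (\<rho> Y (W \<inter> Y) v))) = G V (f V s t)"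
proof -
  have const: "G (W \<inter> Y) (f (W \<inter> Y) (\<rho> W (W \<inter> Y) u) (\<rho> Y (W \<inter> Y) v)) = G V (f V s t)"
    if Wu: "(W, u) \<in> G V s" and Yv: "(Y, v) \<in> G V t" for W u Y v
  proof -
    have W: "nbhd W" "u \<in> carrier (S W)" "G W u = G V s" using Wu mem_germ_iff V by auto
    have Y: "nbhd Y" "v \<in> carrier (S Y)" "G Y v = G V t" using Yv mem_germ_iff V by auto
    obtain Z where Z: "nbhd Z" "Z \<subseteq> W \<inter> V" "\<rho> W Z u = \<rho> V Z s"
      using W V germ_eq_iff[of W u V s] by auto
    obtain Z' where Z': "nbhd Z'" "Z' \<subseteq> Y \<inter> V" "\<rho> Y Z' v = \<rho> V Z' t"
      using Y V germ_eq_iff[of Y v V t] by auto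
    let ?A = "W \<inter> Y" and ?Z = "Z \<inter> Z'"
    have A: "nbhd ?A" using W Y by (auto intro: openin_Int)
    have ZZ: "nbhd ?Z" using Z Z' by (auto intro: openin_Int)
    have "\<rho> ?A ?Z (\<rho> W ?A u) = \<rho> W ?Z u"
      by (rule restriction_comp) (use W A ZZ Z Z' in auto)
    also have "\<dots> = \<rho> Z ?Z (\<rho> W Z u)"
      by (rule restriction_comp[symmetric]) (use W A ZZ Z Z' in auto)
    also have "\<dots> = \<rho> V ?Z s"
      unfolding Z(3) by (rule restriction_comp) (use V ZZ Z Z' in auto)
    finally have u: "\<rho> ?A ?Z (\<rho> W ?A u) = \<rho> V ?Z s" .
    have "\<rho> ?A ?Z (\<rho> Y ?A v) = \<rho> Y ?Z v"
      by (rule restriction_comp) (use Y A ZZ Z Z' in auto)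
    also have "\<dots> = \<rho> Z' ?Z (\<rho> Y Z' v)"
      by (rule restriction_comp[symmetric]) (use Y A ZZ Z Z' in auto)
    also have "\<dots> = \<rho> V ?Z t"
      unfolding Z'(3) by (rule restriction_comp) (use V ZZ Z Z' in auto)
    finally have v: "\<rho> ?A ?Z (\<rho> Y ?A v) = \<rho> V ?Z t" .
    have uv: "\<rho> W ?A u \<in> carrier (S ?A)" "\<rho> Y ?A v \<in> carrier (S ?A)"
      using W Y A by (auto intro: restriction_closed)
    have sub: "?Z \<subseteq> ?A" "?Z \<subseteq> V" using Z(2) Z'(2) by auto
    have "\<rho> ?A ?Z (f ?A (\<rho> W ?A u) (\<rho> Y ?A v)) = \<rho> V ?Z (f V s t)"
      unfolding restrict[OF A ZZ sub(1) uv] restrict[OF V(1) ZZ sub(2) V(2,3)] u v ..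
    then have "\<exists>Z. nbhd Z \<and> Z \<subseteq> ?A \<inter> V \<and> \<rho> ?A Z (f ?A (\<rho> W ?A u) (\<rho> Y ?A v)) = \<rho> V Z (f V s t)"
      using ZZ sub by (intro exI[of _ ?Z]) blast
    then show ?thesis
      unfolding germ_eq_iff[OF A closed[OF A uv] V(1) closed[OF V]] .
  qed
  have mem: "(V, s) \<in> G V s" "(V, t) \<in> G V t" using V mem_germ_iff by auto
  show ?thesis
  proof (intro equalityI subsetI)
    fix z assume "z \<in> G V (f V s t)"
    then show "z \<in> (\<Union>(W, u)\<in>G V s. \<Union>(Y, v)\<in>G V t. G (W \<inter> Y) (f (W \<inter> Y) (\<rho> W (W \<inter> Y) u) (\<rho> Y (W \<inter> Y) v)))"
      using const[OF mem] mem by blast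
  qed (use const in auto)
qed

lemma germ_mult:
  assumes "nbhd V" "s \<in> carrier (S V)" "t \<in> carrier (S V)"
  shows "G V s \<otimes>\<^bsub>St\<^esub> G V t = G V (s \<otimes>\<^bsub>S V\<^esub> t)"
proof -
  have "G V s \<otimes>\<^bsub>St\<^esub> G V t = (\<Union>(W, u)\<in>G V s. \<Union>(Y, v)\<in>G V t.
      G (W \<inter> Y) (\<rho> W (W \<inter> Y) u \<otimes>\<^bsub>S (W \<inter> Y)\<^esub> \<rho> Y (W \<inter> Y) v))"
    by (simp add: stalk_def)
  also have "\<dots> = G V (s \<otimes>\<^bsub>S V\<^esub> t)"
  proof (rule germ_operation[where f = "\<lambda>V. monoid.mult (S V)"])
    show "s \<otimes>\<^bsub>S V\<^esub> t \<in> carrier (S V)" if "nbhd V" "s \<in> carrier (S V)" "t \<in> carrier (S V)" for V s t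
      using ring.ring_simprules(5)[OF ring_sections] that by blast
    show "\<rho> V W (s \<otimes>\<^bsub>S V\<^esub> t) = \<rho> V W s \<otimes>\<^bsub>S W\<^esub> \<rho> V W t"
      if "nbhd V" "nbhd W" "W \<subseteq> V" "s \<in> carrier (S V)" "t \<in> carrier (S V)" for V W s t
      using ring_hom_mult[OF restriction_hom] that by blast
  qed (use assms in auto)
  finally show ?thesis .
qed

lemma germ_add:
  assumes "nbhd V" "s \<in> carrier (S V)" "t \<in> carrier (S V)"
  shows "G V s \<oplus>\<^bsub>St\<^esub> G V t = G V (s \<oplus>\<^bsub>S V\<^esub> t)"
proof -
  have "G V s \<oplus>\<^bsub>St\<^esub> G V t = (\<Union>(W, u)\<in>G V s. \<Union>(Y, v)\<in>G V t.
      G (W \<inter> Y) (\<rho> W (W \<inter> Y) u \<oplus>\<^bsub>S (W \<inter> Y)\<^esub> \<rho> Y (W \<inter> Y) v))"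
    by (simp add: stalk_def)
  also have "\<dots> = G V (s \<oplus>\<^bsub>S V\<^esub> t)"
  proof (rule germ_operation[where f = "\<lambda>V. add (S V)"])
    show "s \<oplus>\<^bsub>S V\<^esub> t \<in> carrier (S V)" if "nbhd V" "s \<in> carrier (S V)" "t \<in> carrier (S V)" for V s t
      using ring.ring_simprules(1)[OF ring_sections] that by blast
    show "\<rho> V W (s \<oplus>\<^bsub>S V\<^esub> t) = \<rho> V W s \<oplus>\<^bsub>S W\<^esub> \<rho> V W t"
      if "nbhd V" "nbhd W" "W \<subseteq> V" "s \<in> carrier (S V)" "t \<in> carrier (S V)" for V W s t
      using ring_hom_add[OF restriction_hom] that by blast
  qed (use assms in auto)
  finally show ?thesis .
qed

lemma germ_one:
  assumes "nbhd V"
  shows "\<one>\<^bsub>St\<^esub> = G V \<one>\<^bsub>S V\<^esub>"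
proof -
  have sub: "V \<subseteq> topspace X" using assms openin_subset by blast
  have "\<rho> (topspace X) V \<one>\<^bsub>S (topspace X)\<^esub> = \<one>\<^bsub>S V\<^esub>"
    by (rule ring_hom_one[OF restriction_hom]) (use assms sub in auto)
  moreover have "\<one>\<^bsub>S (topspace X)\<^esub> \<in> carrier (S (topspace X))"
    using ring.ring_simprules(6)[OF ring_sections] by simp
  ultimately show ?thesis
    using germ_restriction[OF nbhd_topspace, of "\<one>\<^bsub>S (topspace X)\<^esub>" V] assms sub by (simp add: stalk_def)
qed

lemma germ_zero:
  assumes "nbhd V"
  shows "\<zero>\<^bsub>St\<^esub> = G V \<zero>\<^bsub>S V\<^esub>"
proof -
  have sub: "V \<subseteq> topspace X" using assms openin_subset by blast
  interpret hom: ring_hom_ring "S (topspace X)" "S V" "\<rho> (topspace X) V"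
    by (rule restriction_ring_hom) (use assms sub in auto)
  have "\<rho> (topspace X) V \<zero>\<^bsub>S (topspace X)\<^esub> = \<zero>\<^bsub>S V\<^esub>" by (rule hom.hom_zero)
  then show ?thesis
    using germ_restriction[OF nbhd_topspace, of "\<zero>\<^bsub>S (topspace X)\<^esub>" V] assms sub by (simp add: stalk_def)
qed

text \<open>
  Finitely many germs are represented over one neighbourhood, the intersection of the given ones. The
  sets \<open>A k V\<close> transport a property of sections that is stable under restriction, such as being
  homogeneous of a given degree. Intersecting with the whole space covers the empty family.
\<close>

lemma finite_common_neighbourhood:
  assumes K: "finite K" and rep: "\<And>k. k \<in> K \<Longrightarrow> \<exists>V s. nbhd V \<and> s \<in> A k V \<and> c k = G V s"
    and A: "\<And>k V. k \<in> K \<Longrightarrow> nbhd V \<Longrightarrow> A k V \<subseteq> carrier (S V)"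
    and restrict: "\<And>k V W s. \<lbrakk>k \<in> K; nbhd V; nbhd W; W \<subseteq> V; s \<in> A k V\<rbrakk> \<Longrightarrow> \<rho> V W s \<in> A k W"
  shows "\<exists>V s. nbhd V \<and> (\<forall>k\<in>K. s k \<in> A k V \<and> c k = G V (s k))"
proof -
  obtain V s where Vs: "\<And>k. k \<in> K \<Longrightarrow> nbhd (V k) \<and> s k \<in> A k (V k) \<and> c k = G (V k) (s k)"
    using rep by metis
  define W where "W = topspace X \<inter> \<Inter> (V ` K)"
  have W: "nbhd W"
  proof (cases "K = {}")
    case False
    then have "openin X (\<Inter> (V ` K))" using K Vs by (intro openin_Inter) auto
    then show ?thesis using Vs point by (auto simp: W_def intro: openin_Int)
  qed (simp add: W_def point)
  have "\<rho> (V k) W (s k) \<in> A k W \<and> c k = G W (\<rho> (V k) W (s k))" if k: "k \<in> K" for k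
  proof -
    have sub: "W \<subseteq> V k" using k by (auto simp: W_def)
    have "s k \<in> carrier (S (V k))" using A[OF k] Vs[OF k] by blast
    then have "G W (\<rho> (V k) W (s k)) = G (V k) (s k)"
      using germ_restriction Vs[OF k] W sub by blast
    then show ?thesis using restrict[OF k _ W sub] Vs[OF k] by auto
  qed
  then show ?thesis
    using W by (intro exI[of _ W] exI[of _ "\<lambda>k. \<rho> (V k) W (s k)"]) blast
qed

lemma common_neighbourhood3:
  assumes "a \<in> carrier St" "b \<in> carrier St" "c \<in> carrier St"
  obtains V r s t where "nbhd V" "r \<in> carrier (S V)" "s \<in> carrier (S V)" "t \<in> carrier (S V)"
    "a = G V r" "b = G V s" "c = G V t"
proof -
  have "\<exists>V s. nbhd V \<and> (\<forall>k\<in>{0, 1, 2::nat}. s k \<in> carrier (S V) \<and> [a, b, c] ! k = G V (s k))"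
  proof (rule finite_common_neighbourhood)
    show "\<exists>V s. nbhd V \<and> s \<in> carrier (S V) \<and> [a, b, c] ! k = G V s" if "k \<in> {0, 1, 2}" for k
      using that assms unfolding stalk_carrier_iff by (elim insertE emptyE) simp_all
  qed (use restriction_closed in auto)
  then obtain V s where "nbhd V" "\<forall>k\<in>{0, 1, 2::nat}. s k \<in> carrier (S V) \<and> [a, b, c] ! k = G V (s k)"
    by blast
  then show ?thesis by (intro that[of V "s 0" "s 1" "s 2"]) simp_all
qed

text \<open>
  An identity between at most three germs is an identity in the ring of sections over a common
  neighbourhood.
\<close>

lemma ring_stalk: "ring St"
proof (rule ringI)
  note closed = ring.ring_simprules(1,5)[OF ring_sections]
  have zero: "\<zero>\<^bsub>St\<^esub> \<in> carrier St"
    unfolding germ_zero[OF nbhd_topspace] by (intro germ_closed nbhd_topspace ring.ring_simprules(2) ring_sections) simp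
  have one: "\<one>\<^bsub>St\<^esub> \<in> carrier St"
    unfolding germ_one[OF nbhd_topspace] by (intro germ_closed nbhd_topspace ring.ring_simprules(6) ring_sections) simp
  have ops: "a \<oplus>\<^bsub>St\<^esub> b \<in> carrier St" "a \<otimes>\<^bsub>St\<^esub> b \<in> carrier St" "a \<oplus>\<^bsub>St\<^esub> b = b \<oplus>\<^bsub>St\<^esub> a"
    "\<zero>\<^bsub>St\<^esub> \<oplus>\<^bsub>St\<^esub> a = a" "\<one>\<^bsub>St\<^esub> \<otimes>\<^bsub>St\<^esub> a = a" "a \<otimes>\<^bsub>St\<^esub> \<one>\<^bsub>St\<^esub> = a"
    "\<exists>y\<in>carrier St. y \<oplus>\<^bsub>St\<^esub> a = \<zero>\<^bsub>St\<^esub>"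
    if ab: "a \<in> carrier St" "b \<in> carrier St" for a b
  proof -
    obtain V s t r where V: "nbhd V" and st: "s \<in> carrier (S V)" "t \<in> carrier (S V)" "r \<in> carrier (S V)"
        "a = G V s" "b = G V t" "b = G V r"
      by (rule common_neighbourhood3[OF ab ab(2)])
    interpret SV: ring "S V" using ring_sections V by blast
    note eqs = germ_zero[OF V] germ_one[OF V] germ_add[OF V] germ_mult[OF V] germ_closed[OF V]
    show "a \<oplus>\<^bsub>St\<^esub> b \<in> carrier St" "a \<otimes>\<^bsub>St\<^esub> b \<in> carrier St" "a \<oplus>\<^bsub>St\<^esub> b = b \<oplus>\<^bsub>St\<^esub> a"
      "\<zero>\<^bsub>St\<^esub> \<oplus>\<^bsub>St\<^esub> a = a" "\<one>\<^bsub>St\<^esub> \<otimes>\<^bsub>St\<^esub> a = a" "a \<otimes>\<^bsub>St\<^esub> \<one>\<^bsub>St\<^esub> = a"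
      using st by (simp_all add: eqs SV.a_comm)
    show "\<exists>y\<in>carrier St. y \<oplus>\<^bsub>St\<^esub> a = \<zero>\<^bsub>St\<^esub>"
      using st by (intro bexI[of _ "G V (\<ominus>\<^bsub>S V\<^esub> s)"]) (simp_all add: eqs SV.l_neg)
  qed
  have ops3: "a \<oplus>\<^bsub>St\<^esub> b \<oplus>\<^bsub>St\<^esub> c = a \<oplus>\<^bsub>St\<^esub> (b \<oplus>\<^bsub>St\<^esub> c)" "a \<otimes>\<^bsub>St\<^esub> b \<otimes>\<^bsub>St\<^esub> c = a \<otimes>\<^bsub>St\<^esub> (b \<otimes>\<^bsub>St\<^esub> c)"
    "(a \<oplus>\<^bsub>St\<^esub> b) \<otimes>\<^bsub>St\<^esub> c = a \<otimes>\<^bsub>St\<^esub> c \<oplus>\<^bsub>St\<^esub> b \<otimes>\<^bsub>St\<^esub> c" "c \<otimes>\<^bsub>St\<^esub> (a \<oplus>\<^bsub>St\<^esub> b) = c \<otimes>\<^bsub>St\<^esub> a \<oplus>\<^bsub>St\<^esub> c \<otimes>\<^bsub>St\<^esub> b"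
    if abc: "a \<in> carrier St" "b \<in> carrier St" "c \<in> carrier St" for a b c
  proof -
    obtain V r s t where V: "nbhd V" and rst: "r \<in> carrier (S V)" "s \<in> carrier (S V)" "t \<in> carrier (S V)"
      "a = G V r" "b = G V s" "c = G V t"
      by (rule common_neighbourhood3[OF abc])
    interpret SV: ring "S V" using ring_sections V by blast
    show "a \<oplus>\<^bsub>St\<^esub> b \<oplus>\<^bsub>St\<^esub> c = a \<oplus>\<^bsub>St\<^esub> (b \<oplus>\<^bsub>St\<^esub> c)" "a \<otimes>\<^bsub>St\<^esub> b \<otimes>\<^bsub>St\<^esub> c = a \<otimes>\<^bsub>St\<^esub> (b \<otimes>\<^bsub>St\<^esub> c)"
      "(a \<oplus>\<^bsub>St\<^esub> b) \<otimes>\<^bsub>St\<^esub> c = a \<otimes>\<^bsub>St\<^esub> c \<oplus>\<^bsub>St\<^esub> b \<otimes>\<^bsub>St\<^esub> c" "c \<otimes>\<^bsub>St\<^esub> (a \<oplus>\<^bsub>St\<^esub> b) = c \<otimes>\<^bsub>St\<^esub> a \<oplus>\<^bsub>St\<^esub> c \<otimes>\<^bsub>St\<^esub> b"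
      using rst by (simp_all add: germ_add[OF V] germ_mult[OF V] SV.a_assoc SV.m_assoc SV.l_distr SV.r_distr)
  qed
  show "abelian_group St"
  proof (rule abelian_groupI)
    show "\<exists>b\<in>carrier St. b \<oplus>\<^bsub>St\<^esub> a = \<zero>\<^bsub>St\<^esub>" "\<zero>\<^bsub>St\<^esub> \<oplus>\<^bsub>St\<^esub> a = a" if "a \<in> carrier St" for a
      by (rule ops(7)[OF that that] ops(4)[OF that that])+
  qed (rule zero ops(1,3) ops3(1); assumption)+
  show "monoid St"
  proof (rule monoidI)
    show "\<one>\<^bsub>St\<^esub> \<otimes>\<^bsub>St\<^esub> a = a" "a \<otimes>\<^bsub>St\<^esub> \<one>\<^bsub>St\<^esub> = a" if "a \<in> carrier St" for a
      by (rule ops(5,6)[OF that that])+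
  qed (rule one ops(2) ops3(2); assumption)+
  show "(a \<oplus>\<^bsub>St\<^esub> b) \<otimes>\<^bsub>St\<^esub> c = a \<otimes>\<^bsub>St\<^esub> c \<oplus>\<^bsub>St\<^esub> b \<otimes>\<^bsub>St\<^esub> c" "c \<otimes>\<^bsub>St\<^esub> (a \<oplus>\<^bsub>St\<^esub> b) = c \<otimes>\<^bsub>St\<^esub> a \<oplus>\<^bsub>St\<^esub> c \<otimes>\<^bsub>St\<^esub> b"
    if "a \<in> carrier St" "b \<in> carrier St" "c \<in> carrier St" for a b c
    using that by (rule ops3(3,4))+
qed

lemma germ_ring_hom: "nbhd V \<Longrightarrow> ring_hom_ring (S V) St (G V)"
  by (intro ring_hom_ringI2 ring_hom_memI ring_stalk)
    (simp_all add: ring_sections germ_closed germ_mult germ_add germ_one[symmetric])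

lemma stalk_component_carrier: "component St k \<subseteq> carrier St"
proof
  fix a assume "a \<in> component St k"
  then obtain V s where V: "nbhd V" "s \<in> component (S V) k" "a = G V s"
    unfolding stalk_component_iff by blast
  have "s \<in> carrier (S V)" using V component_sections_carrier by blast
  then show "a \<in> carrier St" unfolding V(3) by (rule germ_closed[OF V(1)])
qed

lemma components_common_neighbourhood:
  assumes "finite K" "\<And>k. k \<in> K \<Longrightarrow> c k \<in> component St (e k)"
  shows "\<exists>V s. nbhd V \<and> (\<forall>k\<in>K. s k \<in> component (S V) (e k) \<and> c k = G V (s k))"
proof (rule finite_common_neighbourhood[OF assms(1), where A = "\<lambda>k V. component (S V) (e k)"])
  show "\<exists>V s. nbhd V \<and> s \<in> component (S V) (e k) \<and> c k = G V s" if "k \<in> K" for k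
    using assms(2)[OF that] unfolding stalk_component_iff .
  show "component (S V) (e k) \<subseteq> carrier (S V)" if "nbhd V" for k V
    using component_sections_carrier that by blast
  show "\<rho> V W s \<in> component (S W) (e k)"
    if "nbhd V" "nbhd W" "W \<subseteq> V" "s \<in> component (S V) (e k)" for k V W s
    using restriction_degree that by blast
qed

lemma stalk_component_subgroup: "additive_subgroup (component St k) St"
proof -
  interpret St: ring St by (rule ring_stalk)
  show ?thesis
  proof (rule St.additive_subgroup_intro)
    show "component St k \<subseteq> carrier St" by (rule stalk_component_carrier)
    have "\<zero>\<^bsub>S (topspace X)\<^esub> \<in> component (S (topspace X)) k"
      by (rule additive_subgroup.zero_closed[OF graded_ring.component_subgroup[OF graded_ring_sections]]) simp
    then show "\<zero>\<^bsub>St\<^esub> \<in> component St k"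
      unfolding stalk_component_iff germ_zero[OF nbhd_topspace] using nbhd_topspace by blast
  next
    fix a b assume ab: "a \<in> component St k" "b \<in> component St k"
    have "\<exists>V s. nbhd V \<and> (\<forall>i\<in>{0, 1::nat}. s i \<in> component (S V) k \<and> [a, b] ! i = G V (s i))"
      by (rule components_common_neighbourhood) (use ab in auto)
    then obtain V s where V: "nbhd V" and s: "\<forall>i\<in>{0, 1::nat}. s i \<in> component (S V) k \<and> [a, b] ! i = G V (s i)"
      by blast
    have st: "s 0 \<in> component (S V) k" "s 1 \<in> component (S V) k" "a = G V (s 0)" "b = G V (s 1)"
      using s by simp_all
    interpret C: additive_subgroup "component (S V) k" "S V"
      by (rule graded_ring.component_subgroup[OF graded_ring_sections]) (simp add: V)
    have "a \<oplus>\<^bsub>St\<^esub> b = G V (s 0 \<oplus>\<^bsub>S V\<^esub> s 1)"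
      using st C.a_subset by (simp add: germ_add[OF V] subset_iff)
    then show "a \<oplus>\<^bsub>St\<^esub> b \<in> component St k"
      unfolding stalk_component_iff using V C.a_closed[OF st(1,2)] by blast
  next
    fix a assume "a \<in> component St k"
    then obtain V s where V: "nbhd V" and s: "s \<in> component (S V) k" "a = G V s"
      unfolding stalk_component_iff by blast
    interpret C: additive_subgroup "component (S V) k" "S V"
      by (rule graded_ring.component_subgroup[OF graded_ring_sections]) (simp add: V)
    interpret hom: ring_hom_ring "S V" St "G V" by (rule germ_ring_hom[OF V])
    have "\<ominus>\<^bsub>St\<^esub> a = G V (\<ominus>\<^bsub>S V\<^esub> s)"
      using s C.a_subset by (simp add: subset_iff)
    then show "\<ominus>\<^bsub>St\<^esub> a \<in> component St k"
      unfolding stalk_component_iff using V C.a_inv_closed[OF s(1)] by blast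
  qed
qed

lemma stalk_decomposition:
  assumes V: "nbhd V" and c: "graded_family (S V) (component (S V)) c"
  shows "graded_family St (component St) (\<lambda>k. G V (c k))"
    and "family_sum St (\<lambda>k. G V (c k)) = G V (family_sum (S V) c)"
proof -
  interpret hom: ring_hom_ring "S V" St "G V" by (rule germ_ring_hom[OF V])
  let ?K = "{k. c k \<noteq> \<zero>\<^bsub>S V\<^esub>}"
  have ck: "c k \<in> component (S V) k" "c k \<in> carrier (S V)" for k
    using graded_family_sections[OF _ c] V by simp_all
  have supp: "{k. G V (c k) \<noteq> \<zero>\<^bsub>St\<^esub>} \<subseteq> ?K" by auto
  have fin: "finite ?K" using c by (simp add: graded_family_def)
  show fam: "graded_family St (component St) (\<lambda>k. G V (c k))"
    unfolding graded_family_def stalk_component_iff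
    using finite_subset[OF supp fin] V ck(1) by blast
  have "family_sum St (\<lambda>k. G V (c k)) = finsum St (\<lambda>k. G V (c k)) ?K"
    by (rule hom.S.family_sum_superset[OF fam stalk_component_carrier fin supp])
  also have "\<dots> = G V (family_sum (S V) c)"
    unfolding family_sum_def using hom.hom_finsum[of c ?K] ck(2) by (simp add: o_def)
  finally show "family_sum St (\<lambda>k. G V (c k)) = G V (family_sum (S V) c)" .
qed

text \<open>
  A graded family has infinitely many members, but only finitely many are nonzero; the others are
  represented by the zero section over any neighbourhood.
\<close>

lemma stalk_family_representatives:
  assumes "graded_family St (component St) c"
  obtains V s where "nbhd V" "graded_family (S V) (component (S V)) s" "c = (\<lambda>k. G V (s k))"
proof -
  let ?K = "{k. c k \<noteq> \<zero>\<^bsub>St\<^esub>}"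
  have "finite ?K" "\<And>k. c k \<in> component St k" using assms by (auto simp: graded_family_def)
  then have "\<exists>V s. nbhd V \<and> (\<forall>k\<in>?K. s k \<in> component (S V) k \<and> c k = G V (s k))"
    by (rule components_common_neighbourhood)
  then obtain V s where V: "nbhd V" and s: "\<forall>k\<in>?K. s k \<in> component (S V) k \<and> c k = G V (s k)"
    by blast
  define t where "t k = (if k \<in> ?K then s k else \<zero>\<^bsub>S V\<^esub>)" for k
  have "\<zero>\<^bsub>S V\<^esub> \<in> component (S V) k" for k
    by (rule additive_subgroup.zero_closed[OF graded_ring.component_subgroup[OF graded_ring_sections]]) (simp add: V)
  then have "\<forall>k. t k \<in> component (S V) k" using s by (simp add: t_def)
  moreover have "{k. t k \<noteq> \<zero>\<^bsub>S V\<^esub>} \<subseteq> ?K" by (auto simp: t_def)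
  ultimately have "graded_family (S V) (component (S V)) t"
    using \<open>finite ?K\<close> finite_subset unfolding graded_family_def by blast
  moreover have "c = (\<lambda>k. G V (t k))"
    by (rule ext) (use s germ_zero[OF V] in \<open>simp add: t_def\<close>)
  ultimately show ?thesis by (rule that[OF V])
qed

lemma restriction_graded_family:
  assumes V: "nbhd V" "nbhd W" "W \<subseteq> V" and c: "graded_family (S V) (component (S V)) c"
  shows "graded_family (S W) (component (S W)) (\<lambda>k. \<rho> V W (c k))"
    and "family_sum (S W) (\<lambda>k. \<rho> V W (c k)) = \<rho> V W (family_sum (S V) c)"
proof -
  interpret hom: ring_hom_ring "S V" "S W" "\<rho> V W" by (rule restriction_ring_hom) (use V in auto)
  let ?K = "{k. c k \<noteq> \<zero>\<^bsub>S V\<^esub>}"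
  have ck: "c k \<in> component (S V) k" "c k \<in> carrier (S V)" for k
    using graded_family_sections[OF _ c] V by simp_all
  have supp: "{k. \<rho> V W (c k) \<noteq> \<zero>\<^bsub>S W\<^esub>} \<subseteq> ?K" by auto
  have fin: "finite ?K" using c by (simp add: graded_family_def)
  have "\<rho> V W (c k) \<in> component (S W) k" for k
    using restriction_degree V ck(1) by blast
  then show fam: "graded_family (S W) (component (S W)) (\<lambda>k. \<rho> V W (c k))"
    unfolding graded_family_def using finite_subset[OF supp fin] by blast
  have "component (S W) k \<subseteq> carrier (S W)" for k
    using component_sections_carrier V by blast
  then have "family_sum (S W) (\<lambda>k. \<rho> V W (c k)) = finsum (S W) (\<lambda>k. \<rho> V W (c k)) ?K"
    by (rule hom.S.family_sum_superset[OF fam _ fin supp])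
  also have "\<dots> = \<rho> V W (family_sum (S V) c)"
    unfolding family_sum_def using hom.hom_finsum[of c ?K] ck(2) by (simp add: o_def)
  finally show "family_sum (S W) (\<lambda>k. \<rho> V W (c k)) = \<rho> V W (family_sum (S V) c)" .
qed

text \<open>
  Two decompositions of one germ are represented by graded families of sections. Their sums agree on
  some smaller neighbourhood \<open>Z\<close>, and uniqueness of decompositions in the ring of sections over \<open>Z\<close>
  makes the families agree there.
\<close>

theorem graded_ring_stalk: "graded_ring St"
proof -
  interpret St: ring St by (rule ring_stalk)
  show ?thesis
  proof
    show "internal_direct_sum St (component St) (carrier St)"
      unfolding internal_direct_sum_def
    proof (intro conjI allI stalk_component_subgroup)
      show "carrier St = family_sum St ` {c. graded_family St (component St) c}"
      proof (intro equalityI subsetI)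
        fix a assume "a \<in> carrier St"
        then obtain V s where V: "nbhd V" and s: "s \<in> carrier (S V)" "a = G V s"
          unfolding stalk_carrier_iff by blast
        interpret SV: graded_ring "S V" by (rule graded_ring_sections) (simp add: V)
        obtain c where c: "graded_family (S V) (component (S V)) c" "family_sum (S V) c = s"
          by (rule SV.homogeneous_decomposition[OF s(1)])
        from stalk_decomposition[OF V c(1)] show "a \<in> family_sum St ` {c. graded_family St (component St) c}"
          unfolding s(2) c(2) by (metis (mono_tags, lifting) image_eqI mem_Collect_eq)
      next
        fix a assume "a \<in> family_sum St ` {c. graded_family St (component St) c}"
        then obtain c where c: "graded_family St (component St) c" "a = family_sum St c" by blast
        have "c k \<in> carrier St" for k
          using c(1) stalk_component_carrier by (auto simp: graded_family_def)
        then show "a \<in> carrier St"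
          unfolding c(2) family_sum_def by (intro St.finsum_closed) simp
      qed
      show "inj_on (family_sum St) {c. graded_family St (component St) c}"
      proof (rule inj_onI)
        fix c e assume "c \<in> {c. graded_family St (component St) c}" "e \<in> {c. graded_family St (component St) c}"
          and eq: "family_sum St c = family_sum St e"
        then have ce: "graded_family St (component St) c" "graded_family St (component St) e" by simp_all
        obtain V s where V: "nbhd V" and s: "graded_family (S V) (component (S V)) s" and c: "c = (\<lambda>k. G V (s k))"
          by (rule stalk_family_representatives[OF ce(1)])
        obtain W t where W: "nbhd W" and t: "graded_family (S W) (component (S W)) t" and e: "e = (\<lambda>k. G W (t k))"
          by (rule stalk_family_representatives[OF ce(2)])
        have sk: "s k \<in> carrier (S V)" and tk: "t k \<in> carrier (S W)" for k
          using graded_family_sections[OF _ s] graded_family_sections[OF _ t] V W by simp_all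
        interpret SV: ring "S V" by (rule ring_sections) (simp add: V)
        interpret SW: ring "S W" by (rule ring_sections) (simp add: W)
        have sums: "family_sum (S V) s \<in> carrier (S V)" "family_sum (S W) t \<in> carrier (S W)"
          unfolding family_sum_def using sk tk by (auto intro: SV.finsum_closed SW.finsum_closed)
        have "G V (family_sum (S V) s) = G W (family_sum (S W) t)"
          using eq unfolding c e stalk_decomposition(2)[OF V s] stalk_decomposition(2)[OF W t] .
        then obtain Z where Z: "nbhd Z" "Z \<subseteq> V \<inter> W" "\<rho> V Z (family_sum (S V) s) = \<rho> W Z (family_sum (S W) t)"
          unfolding germ_eq_iff[OF V sums(1) W sums(2)] by blast
        have ZV: "Z \<subseteq> V" and ZW: "Z \<subseteq> W" using Z(2) by auto
        interpret SZ: graded_ring "S Z" by (rule graded_ring_sections) (simp add: Z)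
        have "inj_on (family_sum (S Z)) {c. graded_family (S Z) (component (S Z)) c}"
          using SZ.direct_sum_components by (simp add: internal_direct_sum_def)
        moreover have "family_sum (S Z) (\<lambda>k. \<rho> V Z (s k)) = family_sum (S Z) (\<lambda>k. \<rho> W Z (t k))"
          unfolding restriction_graded_family(2)[OF V Z(1) ZV s] restriction_graded_family(2)[OF W Z(1) ZW t]
          by (rule Z(3))
        ultimately have st: "(\<lambda>k. \<rho> V Z (s k)) = (\<lambda>k. \<rho> W Z (t k))"
          using restriction_graded_family(1)[OF V Z(1) ZV s] restriction_graded_family(1)[OF W Z(1) ZW t]
          by (auto dest: inj_onD)
        have "G V (s k) = G W (t k)" for k
          unfolding germ_eq_iff[OF V sk W tk] using Z(1,2) fun_cong[OF st, of k] by blast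
        then show "c = e" unfolding c e by (rule ext)
      qed
    qed
    show "a \<otimes>\<^bsub>St\<^esub> b \<in> component St (i + j)" if ab: "a \<in> component St i" "b \<in> component St j" for a b i j
    proof -
      have "\<exists>V s. nbhd V \<and> (\<forall>l\<in>{0, 1::nat}. s l \<in> component (S V) ([i, j] ! l) \<and> [a, b] ! l = G V (s l))"
        by (rule components_common_neighbourhood) (use ab in auto)
      then obtain V s where V: "nbhd V"
        and s: "\<forall>l\<in>{0, 1::nat}. s l \<in> component (S V) ([i, j] ! l) \<and> [a, b] ! l = G V (s l)"
        by blast
      have st: "s 0 \<in> component (S V) i" "s 1 \<in> component (S V) j" "a = G V (s 0)" "b = G V (s 1)"
        using s by simp_all
      interpret SV: graded_ring "S V" by (rule graded_ring_sections) (simp add: V)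
      have "a \<otimes>\<^bsub>St\<^esub> b = G V (s 0 \<otimes>\<^bsub>S V\<^esub> s 1)"
        unfolding st(3,4) by (rule germ_mult[OF V]) (use st SV.component_carrier in auto)
      then show ?thesis
        unfolding stalk_component_iff using V SV.component_mult[OF st(1,2)] by blast
    qed
  qed
qed

end

section \<open>Inverting a series with nowhere vanishing constant term\<close>

lemma proper_factor_shorter:
  assumes fac: "(u, v) \<in> factorizations B d m" and "(u, v) \<noteq> ([], m)"
  shows "length v < length m"
proof -
  have "v \<in> monomials B d" "sort (u @ v) = m" using fac by (auto simp: factorizations_def)
  then have "u \<noteq> []" using assms(2) by (auto simp: monomials_sorted sorted_sort_id)
  moreover have "length u + length v = length m" using factorization_set[OF fac] by blast
  ultimately show ?thesis by (cases u) auto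
qed

text \<open>
  Comparing the coefficients of \<open>m\<close> in \<open>f g = 1\<close> and solving for \<open>g m\<close>, which occurs with factor
  \<open>f []\<close> in the summand of the factorization \<open>([], m)\<close>. All other summands involve \<open>g\<close> only at
  shorter words. This is the geometric series for \<open>1 / f\<close>, written coefficientwise so that no
  convergence has to be discussed.
\<close>

function reciprocal :: "'b::linorder set \<Rightarrow> ('b \<Rightarrow> int) \<Rightarrow> 'b series \<Rightarrow> 'b series" where
  "reciprocal B d f m = (\<lambda>x. inverse (f [] x) * ((if m = [] then 1 else 0) +
     (\<Sum>p\<in>factorizations B d m - {([], m)}.
        - koszul_sign d (fst p @ snd p) * f (fst p) x * reciprocal B d f (snd p) x)))"
  by auto
termination
proof (relation "Wellfounded.measure (\<lambda>(B, d, f, m). length m)")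
  fix B :: "'b::linorder set" and d and f :: "'b series" and m p
  assume "p \<in> factorizations B d m - {([], m)}"
  then show "((B, d, f, snd p), B, d, f, m) \<in> Wellfounded.measure (\<lambda>(B, d, f, m). length m)"
    using proper_factor_shorter[of "fst p" "snd p" B d m] by simp
qed simp

declare reciprocal.simps [simp del]

context domain_sections
begin

lemma proper_factorization:
  assumes "p \<in> factorizations B d m - {([], m)}"
  shows "fst p \<in> M" "snd p \<in> M" "length (snd p) < length m"
    "word_degree d m = word_degree d (fst p) + word_degree d (snd p)"
proof -
  obtain u v where uv: "p = (u, v)" by (cases p)
  have fac: "(u, v) \<in> factorizations B d m" using assms uv by simp
  note D = factorizationsD[OF fac]
  show "fst p \<in> M" "snd p \<in> M" "word_degree d m = word_degree d (fst p) + word_degree d (snd p)"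
    using D uv by simp_all
  show "length (snd p) < length m"
    using proper_factor_shorter[OF fac] assms uv by simp
qed

lemma reciprocal_smooth:
  assumes f: "f \<in> carrier R" "\<And>x. x \<in> V \<Longrightarrow> f [] x \<noteq> 0"
  shows "m \<in> M \<Longrightarrow> smooth_on n V (reciprocal B d f m)"
proof (induction m rule: length_induct)
  case (1 m)
  have "smooth_on n V (\<lambda>x. - koszul_sign d (fst p @ snd p) * f (fst p) x * reciprocal B d f (snd p) x)"
    if p: "p \<in> factorizations B d m - {([], m)}" for p
  proof (intro smooth_on_mult[OF open_V, of "\<lambda>x. - koszul_sign d (fst p @ snd p) * f (fst p) x"]
      smooth_on_mult[OF open_V, of "\<lambda>x. - koszul_sign d (fst p @ snd p)" "f (fst p)"] smooth_on_const[OF open_V])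
    show "smooth_on n V (f (fst p))" using carrier_smooth[OF f(1)] proper_factorization(1)[OF p] by blast
    show "smooth_on n V (reciprocal B d f (snd p))" using 1 proper_factorization(2,3)[OF p] by blast
  qed
  then have "smooth_on n V (\<lambda>x. \<Sum>p\<in>factorizations B d m - {([], m)}.
      - koszul_sign d (fst p @ snd p) * f (fst p) x * reciprocal B d f (snd p) x)"
    by (rule smooth_on_sum[OF open_V])
  then have "smooth_on n V (\<lambda>x. (if m = [] then 1 else 0) + (\<Sum>p\<in>factorizations B d m - {([], m)}.
      - koszul_sign d (fst p @ snd p) * f (fst p) x * reciprocal B d f (snd p) x))"
    by (rule smooth_on_add[OF open_V smooth_on_const[OF open_V]])
  moreover have "smooth_on n V (\<lambda>x. inverse (f [] x))"
    by (rule smooth_on_inverse[OF open_V carrier_smooth[OF f(1)]]) (simp_all add: f(2))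
  ultimately show ?case
    unfolding reciprocal.simps[of B d f m] by (intro smooth_on_mult[OF open_V])
qed

text \<open>
  If \<open>f\<close> lives in degree \<open>0\<close>, a summand with \<open>f u \<noteq> 0\<close> has \<open>deg v = deg m\<close>, so nonzero degrees never
  arise in the recursion. In particular the inverse has finitely many degrees and is again a section.
\<close>

lemma reciprocal_degree:
  assumes f: "f \<in> component R 0" and x: "x \<in> V"
  shows "m \<in> M \<Longrightarrow> word_degree d m \<noteq> 0 \<Longrightarrow> reciprocal B d f m x = 0"
proof (induction m rule: length_induct)
  case (1 m)
  have "- koszul_sign d (fst p @ snd p) * f (fst p) x * reciprocal B d f (snd p) x = 0"
    if p: "p \<in> factorizations B d m - {([], m)}" for p
  proof (cases "word_degree d (fst p) = 0")
    case True
    then have "word_degree d (snd p) \<noteq> 0" using proper_factorization(4)[OF p] 1(3) by simp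
    then show ?thesis using 1(1) proper_factorization(2,3)[OF p] by simp
  next
    case False
    then have "f (fst p) x = 0" using f x proper_factorization(1)[OF p] unfolding component_iff by blast
    then show ?thesis by simp
  qed
  then have "(\<Sum>p\<in>factorizations B d m - {([], m)}.
      - koszul_sign d (fst p @ snd p) * f (fst p) x * reciprocal B d f (snd p) x) = 0"
    by (rule sum.neutral[OF ballI])
  moreover have "m \<noteq> []" using 1(3) by (auto simp: word_degree_def)
  ultimately show ?case by (simp add: reciprocal.simps[of B d f m])
qed

lemma degree_zero_invertible:
  assumes f: "f \<in> component R 0" and nz: "\<And>x. x \<in> V \<Longrightarrow> f [] x \<noteq> 0"
  shows "\<exists>g\<in>carrier R. f \<otimes>\<^bsub>R\<^esub> g = \<one>\<^bsub>R\<^esub>"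
proof
  let ?g = "\<lambda>m\<in>M. \<lambda>x\<in>V. reciprocal B d f m x"
  have fR: "f \<in> carrier R" using f component_subset_carrier by blast
  have "?g \<in> formal_series n B d V"
    by (rule formal_seriesI) (rule reciprocal_smooth[OF fR nz])
  moreover have "word_degree d m = 0" if "m \<in> M" "x \<in> V" "?g m x \<noteq> 0" for m x
    using that reciprocal_degree[OF f, of x m] by auto
  ultimately have "?g \<in> component R 0" unfolding component_iff by blast
  then show g: "?g \<in> carrier R" using component_subset_carrier by blast
  show "f \<otimes>\<^bsub>R\<^esub> ?g = \<one>\<^bsub>R\<^esub>"
  proof (rule carrier_eqI)
    fix m x assume mx: "m \<in> M" "x \<in> V"
    let ?t = "\<lambda>p. koszul_sign d (fst p @ snd p) * f (fst p) x * reciprocal B d f (snd p) x"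
    have "([], m) \<in> factorizations B d m"
      using mx(1) monomials_sorted[OF mx(1)] by (simp add: factorizations_def sorted_sort_id)
    moreover have "(f \<otimes>\<^bsub>R\<^esub> ?g) m x = (\<Sum>p\<in>factorizations B d m. ?t p)"
      unfolding mult_apply[OF mx]
      by (intro sum.cong refl, clarify) (simp add: factorizationsD(2) mx(2))
    ultimately have "(f \<otimes>\<^bsub>R\<^esub> ?g) m x = ?t ([], m) + (\<Sum>p\<in>factorizations B d m - {([], m)}. ?t p)"
      by (simp only: sum.remove[OF finite_factorizations])
    also have "?t ([], m) = (if m = [] then 1 else 0) - (\<Sum>p\<in>factorizations B d m - {([], m)}. ?t p)"
      using nz[OF mx(2)] monomials_sorted[OF mx(1)]
      by (simp add: koszul_sign_sorted reciprocal.simps[of B d f m] sum_negf)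
    finally show "(f \<otimes>\<^bsub>R\<^esub> ?g) m x = \<one>\<^bsub>R\<^esub> m x" unfolding one_apply[OF mx] diff_add_cancel .
  qed (use mult_closed[OF fR g] one_component component_subset_carrier in auto)
qed

text \<open>
  The empty word factors only trivially, so taking the constant term is multiplicative.
\<close>

lemma constant_term_mult: "x \<in> V \<Longrightarrow> (f \<otimes>\<^bsub>R\<^esub> g) [] x = f [] x * g [] x"
  by (simp add: mult_apply koszul_sign_sorted)

end

section \<open>Stalks of a graded domain are local\<close>

locale domain_point =
  fixes n :: nat and B :: "'b::linorder set" and d :: "'b \<Rightarrow> int" and U :: "(nat \<Rightarrow> real) set" and x
  assumes open_U: "openin (Euclidean_space n) U" and point_U: "x \<in> U"
begin

abbreviation "X \<equiv> subtopology (Euclidean_space n) U"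

sublocale stalk_at X "domain_sheaf n B d" x
proof (intro stalk_at.intro stalk_at_axioms.intro)
  show "graded_presheaf X (domain_sheaf n B d)"
    using domain_sheaf_graded_ringed_space[OF open_U] by (rule graded_ringed_space.axioms(1))
  show "x \<in> topspace X" using point_U openin_subset[OF open_U] by auto
qed

lemma sections: "nbhd V \<Longrightarrow> domain_sections n V"
  using openin_subset_Euclidean_space(1)[OF open_U] by (simp add: domain_sections_def)

lemma germ_constant_term:
  assumes "nbhd V" "s \<in> carrier (S V)" "nbhd W" "t \<in> carrier (S W)" "G V s = G W t"
  shows "s [] x = t [] x"
proof -
  obtain Z where Z: "nbhd Z" "Z \<subseteq> V \<inter> W" "\<rho> V Z s = \<rho> W Z t"
    using assms(5) unfolding germ_eq_iff[OF assms(1-4)] by blast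
  have "\<rho> V Z s [] x = \<rho> W Z t [] x" using Z(3) by simp
  then show ?thesis using Z(1) by (simp add: domain_sheaf_simps)
qed

text \<open>
  The kernel of the evaluation of germs at \<open>x\<close>, which sends a series to the value of its constant term.
\<close>

definition vanishing_germs where
  "vanishing_germs = {G V s | V s. nbhd V \<and> s \<in> carrier (S V) \<and> s [] x = 0}"

lemma germ_vanishing_iff:
  assumes "nbhd V" "s \<in> carrier (S V)"
  shows "G V s \<in> vanishing_germs \<longleftrightarrow> s [] x = 0"
proof
  assume "G V s \<in> vanishing_germs"
  then obtain W t where "nbhd W" "t \<in> carrier (S W)" "t [] x = 0" "G V s = G W t"
    unfolding vanishing_germs_def by blast
  then show "s [] x = 0" using germ_constant_term[OF assms] by simp
qed (use assms in \<open>auto simp: vanishing_germs_def\<close>)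

lemma vanishing_germs_carrier: "vanishing_germs \<subseteq> carrier St"
  unfolding vanishing_germs_def using germ_closed by blast

lemma ideal_vanishing_germs: "ideal vanishing_germs St"
proof -
  interpret St: ring St by (rule ring_stalk)
  have subgroup: "additive_subgroup vanishing_germs St"
  proof (rule St.additive_subgroup_intro)
    interpret T: domain_sections n B d "topspace X" by (rule sections[OF nbhd_topspace])
    show "\<zero>\<^bsub>St\<^esub> \<in> vanishing_germs"
      unfolding germ_zero[OF nbhd_topspace]
      by (subst germ_vanishing_iff[OF nbhd_topspace])
        (use T.zero_closed T.zero_apply[of "[]" x] nbhd_topspace in \<open>auto simp: domain_sheaf_simps\<close>)
  next
    fix a b assume ab: "a \<in> vanishing_germs" "b \<in> vanishing_germs"
    then have car: "a \<in> carrier St" "b \<in> carrier St" using vanishing_germs_carrier by auto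
    obtain V s t r where V: "nbhd V" and st: "s \<in> carrier (S V)" "t \<in> carrier (S V)" "r \<in> carrier (S V)"
        "a = G V s" "b = G V t" "b = G V r"
      by (rule common_neighbourhood3[OF car car(2)])
    interpret V: domain_sections n B d V by (rule sections[OF V])
    have "s [] x = 0" "t [] x = 0" using ab st germ_vanishing_iff[OF V] by auto
    moreover have "s \<oplus>\<^bsub>S V\<^esub> t \<in> carrier (S V)"
      using st V.add_closed by (simp add: domain_sheaf_simps)
    ultimately have "G V (s \<oplus>\<^bsub>S V\<^esub> t) \<in> vanishing_germs"
      using V by (simp add: germ_vanishing_iff) (simp add: domain_sheaf_simps V.add_apply)
    then show "a \<oplus>\<^bsub>St\<^esub> b \<in> vanishing_germs"
      unfolding st(4,5) germ_add[OF V st(1,2)] .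
  next
    fix a assume a: "a \<in> vanishing_germs"
    then obtain V s where V: "nbhd V" and s: "s \<in> carrier (S V)" "s [] x = 0" "a = G V s"
      unfolding vanishing_germs_def by blast
    interpret V: domain_sections n B d V by (rule sections[OF V])
    interpret hom: ring_hom_ring "S V" St "G V" by (rule germ_ring_hom[OF V])
    have neg: "\<ominus>\<^bsub>St\<^esub> a = G V (\<ominus>\<^bsub>S V\<^esub> s)" "\<ominus>\<^bsub>S V\<^esub> s \<in> carrier (S V)" using s by simp_all
    have "(\<ominus>\<^bsub>S V\<^esub> s) [] x = 0"
      using s V V.a_inv_apply[of s "[]" x] by (simp add: domain_sheaf_simps)
    then show "\<ominus>\<^bsub>St\<^esub> a \<in> vanishing_germs"
      unfolding neg(1) germ_vanishing_iff[OF V neg(2)] .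
  qed (rule vanishing_germs_carrier)
  have mult: "a \<otimes>\<^bsub>St\<^esub> b \<in> vanishing_germs"
    if ab: "a \<in> carrier St" "b \<in> carrier St" and van: "a \<in> vanishing_germs \<or> b \<in> vanishing_germs" for a b
  proof -
    obtain V s t r where V: "nbhd V" and st: "s \<in> carrier (S V)" "t \<in> carrier (S V)" "r \<in> carrier (S V)"
        "a = G V s" "b = G V t" "b = G V r"
      by (rule common_neighbourhood3[OF ab ab(2)])
    interpret V: domain_sections n B d V by (rule sections[OF V])
    have "s [] x = 0 \<or> t [] x = 0" using van st germ_vanishing_iff[OF V] by auto
    moreover have "s \<otimes>\<^bsub>S V\<^esub> t \<in> carrier (S V)"
      using st V.mult_closed by (simp add: domain_sheaf_simps)
    ultimately have "G V (s \<otimes>\<^bsub>S V\<^esub> t) \<in> vanishing_germs"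
      using V by (simp add: germ_vanishing_iff) (auto simp: domain_sheaf_simps V.constant_term_mult)
    then show ?thesis unfolding st(4,5) germ_mult[OF V st(1,2)] .
  qed
  show ?thesis
    by (rule idealI[OF ring_stalk additive_subgroup.a_subgroup[OF subgroup]])
      (use mult vanishing_germs_carrier in blast)+
qed

text \<open>
  The constant term sits in degree \<open>0\<close>, so it vanishes for every homogeneous element of nonzero degree.
  A homogeneous germ outside the kernel thus has degree \<open>0\<close> and a constant term that does not vanish
  at \<open>x\<close>, nor in a neighbourhood of \<open>x\<close>, over which it is invertible.
\<close>

theorem local_stalk: "local_graded_ring St"
proof -
  interpret St: graded_ring St by (rule graded_ring_stalk)
  show ?thesis
  proof (rule St.local_graded_ringI)
    show "homogeneous_ideal vanishing_germs St"
    proof (rule St.homogeneous_idealI[OF ideal_vanishing_germs])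
      fix c assume c: "graded_family St (component St) c" and van: "family_sum St c \<in> vanishing_germs"
      obtain V s where V: "nbhd V" and s: "graded_family (S V) (component (S V)) s" and c: "c = (\<lambda>k. G V (s k))"
        by (rule stalk_family_representatives[OF c])
      interpret V: domain_sections n B d V by (rule sections[OF V])
      interpret SV: ring "S V" by (rule ring_sections) (simp add: V)
      have sk: "s k \<in> component (S V) k" "s k \<in> carrier (S V)" for k
        using graded_family_sections[OF _ s] V by simp_all
      have "family_sum (S V) s \<in> carrier (S V)"
        unfolding family_sum_def using sk(2) by (auto intro: SV.finsum_closed)
      then have "family_sum (S V) s [] x = 0"
        using van germ_vanishing_iff[OF V] unfolding c stalk_decomposition(2)[OF V s] by blast
      then have "s 0 [] x = 0"
        using V.family_sum_apply[of s "[]" x] s V by (simp add: domain_sheaf_simps word_degree_def)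
      moreover have "s k [] x = 0" if "k \<noteq> 0" for k
        using sk(1)[of k] that V V.component_iff[of "s k" k] by (force simp: domain_sheaf_simps word_degree_def)
      ultimately have "s k [] x = 0" for k by (cases "k = 0") simp_all
      then show "\<forall>k. c k \<in> vanishing_germs"
        unfolding c using germ_vanishing_iff[OF V sk(2)] by blast
    qed
    show "vanishing_germs \<noteq> carrier St"
    proof -
      interpret T: domain_sections n B d "topspace X" by (rule sections[OF nbhd_topspace])
      have one: "\<one>\<^bsub>S (topspace X)\<^esub> \<in> carrier (S (topspace X))"
        using T.one_component T.component_subset_carrier by (auto simp: domain_sheaf_simps)
      have "\<one>\<^bsub>S (topspace X)\<^esub> [] x = 1"
        using T.one_apply[of "[]" x] nbhd_topspace by (simp add: domain_sheaf_simps)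
      then have "\<one>\<^bsub>St\<^esub> \<notin> vanishing_germs"
        unfolding germ_one[OF nbhd_topspace] germ_vanishing_iff[OF nbhd_topspace one] by simp
      then show ?thesis using St.one_closed by blast
    qed
  next
    fix k a assume a: "a \<in> component St k" "a \<notin> vanishing_germs"
    then obtain V s where V: "nbhd V" and s: "s \<in> component (S V) k" "a = G V s"
      unfolding stalk_component_iff by blast
    have sS: "s \<in> carrier (S V)" using s V component_sections_carrier by blast
    interpret V: domain_sections n B d V by (rule sections[OF V])
    have nz: "s [] x \<noteq> 0" using a(2) germ_vanishing_iff[OF V sS] s(2) by blast
    have "s \<in> component V.R k" using s(1) by (simp add: domain_sheaf_simps)
    then have "word_degree d [] = k" using nz V unfolding V.component_iff by (meson monomials_Nil)
    then have k: "k = 0" by (simp add: word_degree_def)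
    \<comment> \<open>The part of the neighbourhood on which the constant term can be divided by.\<close>
    define Z where "Z = V \<inter> s [] -` (- {0})"
    have "continuous_on V (s [])"
      by (rule smooth_on_continuous[OF V.open_V]) (use sS V.carrier_smooth in \<open>simp add: domain_sheaf_simps\<close>)
    then have "openin (subtopology (Euclidean_space n) V) Z"
      unfolding Z_def subtopology_Euclidean_space[OF V.open_V]
      by (rule continuous_openin_preimage_gen) auto
    then have Z_open: "openin (Euclidean_space n) Z" by (rule openin_subset_Euclidean_space(1)[OF V.open_V])
    have ZV: "Z \<subseteq> V" by (auto simp: Z_def)
    have "V \<subseteq> U" using openin_subset_Euclidean_space(2)[OF open_U] V by blast
    then have Z: "nbhd Z"
      using Z_open ZV V nz open_U by (auto simp: openin_open_subtopology Z_def)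
    interpret Z: domain_sections n B d Z by (rule sections[OF Z])
    have "\<rho> V Z s \<in> component (S Z) 0" using restriction_degree V Z ZV s(1) k by blast
    then have "\<rho> V Z s \<in> component Z.R 0" by (simp add: domain_sheaf_simps)
    moreover have "\<rho> V Z s [] y \<noteq> 0" if "y \<in> Z" for y
      using that by (simp add: domain_sheaf_simps Z_def)
    ultimately obtain g where g: "g \<in> carrier Z.R" "\<rho> V Z s \<otimes>\<^bsub>Z.R\<^esub> g = \<one>\<^bsub>Z.R\<^esub>"
      using Z.degree_zero_invertible by blast
    have gS: "g \<in> carrier (S Z)" using g(1) by (simp add: domain_sheaf_simps)
    have sZ: "\<rho> V Z s \<in> carrier (S Z)" using restriction_closed V Z ZV sS by blast
    have "a \<otimes>\<^bsub>St\<^esub> G Z g = G Z (\<rho> V Z s) \<otimes>\<^bsub>St\<^esub> G Z g"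
      unfolding s(2) germ_restriction[OF V sS Z ZV] ..
    also have "\<dots> = G Z (\<rho> V Z s \<otimes>\<^bsub>S Z\<^esub> g)" by (rule germ_mult[OF Z sZ gS])
    also have "\<dots> = \<one>\<^bsub>St\<^esub>"
      unfolding germ_one[OF Z] using g(2) by (simp add: domain_sheaf_simps)
    finally show "\<exists>b\<in>carrier St. a \<otimes>\<^bsub>St\<^esub> b = \<one>\<^bsub>St\<^esub>" using germ_closed[OF Z gS] by blast
  qed
qed

end

theorem theorem2p6:
  fixes p :: "int \<Rightarrow> nat" and U :: "(nat \<Rightarrow> real) set"
    and B :: "'b::linorder set" and d :: "'b \<Rightarrow> int"
  assumes "openin (Euclidean_space (p 0)) U"
    and "graded_basis p B d"
  shows "graded_locally_ringed_space (subtopology (Euclidean_space (p 0)) U) (domain_sheaf (p 0) B d)"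
proof (intro graded_locally_ringed_space.intro graded_locally_ringed_space_axioms.intro)
  show "graded_ringed_space (subtopology (Euclidean_space (p 0)) U) (domain_sheaf (p 0) B d)"
    using assms(1) by (rule domain_sheaf_graded_ringed_space)
  fix x assume "x \<in> topspace (subtopology (Euclidean_space (p 0)) U)"
  then have "domain_point (p 0) U x"
    using assms(1) by (simp add: domain_point_def)
  then show "local_graded_ring (stalk (subtopology (Euclidean_space (p 0)) U) (domain_sheaf (p 0) B d) x)"
    by (rule domain_point.local_stalk)
qed

end
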